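(* In the setting of the context, the Durbin-Watson statistic satisfies $$\lim_{n\to\infty}\widehat{D}_n=D^{*}\quad\text{almost surely},$$ where $D^{*}=2(1-\rho^{*})$, $\rho^{*}=\theta_p\rho\,\theta_p^{*}$ and $\theta_p^{*}$ is the $p$-th component of $\theta^{*}=\alpha(I_p-\theta_p\rho J_p)\beta$.
   Context: Let $p\ge 1$ be an integer, $\theta=(\theta_1,\dots,\theta_p)'\in\mathbb{R}^p$ a nonzero vector with $\|\theta\|_1=\sum_i|\theta_i|<1$ and $\rho\in\mathbb{R}$ with $|\rho|<1$. A prime denotes transposition. The process is given, for all $n\ge1$, by $$X_n=\theta_1X_{n-1}+\cdots+\theta_pX_{n-p}+\varepsilon_n,\qquad \varepsilon_n=\rho\,\varepsilon_{n-1}+V_n,$$ with square-integrable initial value $X_0=\varepsilon_0$ and $X_{-1}=\cdots=X_{-p}=0$, where $(V_n)$ is a sequence of square-integrable, independent and identically distributed random variables with zero mean and variance $\sigma^2>0$. Let $\Phi_n^p=(X_n,X_{n-1},\dots,X_{n-p+1})'$ and $S_n=\sum_{k=0}^n\Phi_k^p(\Phi_k^p)'+S$, where $S$ is a fixed symmetric positive definite $p\times p$ matrix. The least squares estimator of $\theta$ is $\widehat{\theta}_n=(S_{n-1})^{-1}\sum_{k=1}^n\Phi_{k-1}^pX_k$, $n\ge1$. At stage $n$ the residuals are $\widehat{\varepsilon}_0=X_0$ and $\widehat{\varepsilon}_k=X_k-\widehat{\theta}_n'\Phi_{k-1}^p$ for $1\le k\le n$ (they depend on $n$). The Durbin-Watson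 statistic is, for $n\ge1$, $$\widehat{D}_n=\Bigl(\sum_{k=0}^n\widehat{\varepsilon}_k^{\,2}\Bigr)^{-1}\sum_{k=1}^n(\widehat{\varepsilon}_k-\widehat{\varepsilon}_{k-1})^2.$$ $I_p$ is the identity matrix and $J_p$ the exchange matrix of order $p$ (ones on the antidiagonal, zeros elsewhere), and $$\alpha=\frac{1}{(1-\theta_p\rho)(1+\theta_p\rho)},\qquad \beta=(\theta_1+\rho,\ \theta_2-\theta_1\rho,\ \dots,\ \theta_p-\theta_{p-1}\rho)'.$$ *)

theory Defs
  imports "HOL-Probability.Probability" "Jordan_Normal_Form.Gauss_Jordan_Elimination"
begin

no_notation vec_nth (infixl "$" 90)
no_notation inner (infix "\<bullet>" 70)
hide_const (open) Finite_Cartesian_Product.vec Finite_Cartesian_Product.mat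
hide_type (open) Finite_Cartesian_Product.vec

text \<open>
  The dimension \<open>p\<close> is a natural number, and vectors and matrices are indexed from \<open>0\<close>, so
  \<open>\<theta> $ (i - 1)\<close> is the component written \<open>\<theta>\<^sub>i\<close> on paper. The time index of \<open>X\<close> is an
  integer because the values \<open>X\<^sub>-\<^sub>1, \<dots>, X\<^sub>-\<^sub>p\<close> are used.
\<close>

definition norm1 :: "real vec \<Rightarrow> real" where
  "norm1 v = (\<Sum>i<dim_vec v. \<bar>v $ i\<bar>)"

definition sym_pos_def :: "nat \<Rightarrow> real mat \<Rightarrow> bool" where
  "sym_pos_def p S \<longleftrightarrow> S \<in> carrier_mat p p \<and> transpose_mat S = S \<and>
     (\<forall>v\<in>carrier_vec p. v \<noteq> 0\<^sub>v p \<longrightarrow> v \<bullet> (S *\<^sub>v v) > 0)"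

definition exchange_mat :: "nat \<Rightarrow> real mat" where
  "exchange_mat p = mat p p (\<lambda>(i, j). if i + j = p - 1 then 1 else 0)"

definition Phi :: "nat \<Rightarrow> (int \<Rightarrow> 'a \<Rightarrow> real) \<Rightarrow> nat \<Rightarrow> 'a \<Rightarrow> real vec" where
  "Phi p X n \<omega> = vec p (\<lambda>i. X (int n - int i) \<omega>)"

text \<open>The sum of the rank-one matrices \<open>\<Phi>\<^sub>k \<Phi>\<^sub>k'\<close> is written entrywise, since matrices of this type do
  not form a type-class monoid.\<close>

definition Smat :: "nat \<Rightarrow> (int \<Rightarrow> 'a \<Rightarrow> real) \<Rightarrow> real mat \<Rightarrow> nat \<Rightarrow> 'a \<Rightarrow> real mat" where
  "Smat p X S n \<omega> =
     mat p p (\<lambda>(i, j). \<Sum>k=0..n. Phi p X k \<omega> $ i * Phi p X k \<omega> $ j) + S"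

text \<open>The quantities below are meant for \<open>n \<ge> 1\<close>. When \<open>S\<close> is positive definite, \<open>Smat\<close> is
  invertible, so \<open>mat_inverse\<close> does not return \<open>None\<close>.\<close>

definition theta_hat ::
    "nat \<Rightarrow> (int \<Rightarrow> 'a \<Rightarrow> real) \<Rightarrow> real mat \<Rightarrow> nat \<Rightarrow> 'a \<Rightarrow> real vec" where
  "theta_hat p X S n \<omega> =
     the (mat_inverse (Smat p X S (n - 1) \<omega>)) *\<^sub>v
       vec p (\<lambda>i. \<Sum>k=1..n. Phi p X (k - 1) \<omega> $ i * X (int k) \<omega>)"

definition eps_hat ::
    "nat \<Rightarrow> (int \<Rightarrow> 'a \<Rightarrow> real) \<Rightarrow> real mat \<Rightarrow> nat \<Rightarrow> nat \<Rightarrow> 'a \<Rightarrow> real" where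
  "eps_hat p X S n k \<omega> =
     (if k = 0 then X 0 \<omega> else X (int k) \<omega> - theta_hat p X S n \<omega> \<bullet> Phi p X (k - 1) \<omega>)"

definition DW :: "nat \<Rightarrow> (int \<Rightarrow> 'a \<Rightarrow> real) \<Rightarrow> real mat \<Rightarrow> nat \<Rightarrow> 'a \<Rightarrow> real" where
  "DW p X S n \<omega> =
     inverse (\<Sum>k=0..n. (eps_hat p X S n k \<omega>)\<^sup>2) *
       (\<Sum>k=1..n. (eps_hat p X S n k \<omega> - eps_hat p X S n (k - 1) \<omega>)\<^sup>2)"

definition alpha :: "nat \<Rightarrow> real vec \<Rightarrow> real \<Rightarrow> real" where
  "alpha p \<theta> \<rho> = 1 / ((1 - \<theta> $ (p - 1) * \<rho>) * (1 + \<theta> $ (p - 1) * \<rho>))"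

definition beta :: "nat \<Rightarrow> real vec \<Rightarrow> real \<Rightarrow> real vec" where
  "beta p \<theta> \<rho> = vec p (\<lambda>i. if i = 0 then \<theta> $ 0 + \<rho> else \<theta> $ i - \<theta> $ (i - 1) * \<rho>)"

definition theta_star :: "nat \<Rightarrow> real vec \<Rightarrow> real \<Rightarrow> real vec" where
  "theta_star p \<theta> \<rho> =
     alpha p \<theta> \<rho> \<cdot>\<^sub>v ((1\<^sub>m p - (\<theta> $ (p - 1) * \<rho>) \<cdot>\<^sub>m exchange_mat p) *\<^sub>v beta p \<theta> \<rho>)"

definition rho_star :: "nat \<Rightarrow> real vec \<Rightarrow> real \<Rightarrow> real" where
  "rho_star p \<theta> \<rho> = \<theta> $ (p - 1) * \<rho> * theta_star p \<theta> \<rho> $ (p - 1)"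

definition D_star :: "nat \<Rightarrow> real vec \<Rightarrow> real \<Rightarrow> real" where
  "D_star p \<theta> \<rho> = 2 * (1 - rho_star p \<theta> \<rho>)"

end

theory Submission
  imports Defs "HOL-Library.Discrete_Functions" "HOL-Real_Asymp.Real_Asymp"
    "Jordan_Normal_Form.Determinant"
begin

text \<open>
The proof separates probability from linear algebra. Along one sample path, write
\<open>ip n f g\<close> for the sum of \<open>f k * g k\<close> over \<open>0 \<le> k \<le> n\<close>, divided by \<open>n\<close>. All that is needed
from the noise is that almost surely \<open>ip n V V\<close> tends to \<open>\<sigma>\<^sup>2\<close> and \<open>ip n V (lag j V)\<close> tends to
\<open>0\<close> for every \<open>j \<ge> 1\<close>. The second fact is a law of large numbers for orthogonal variables with
bounded second moments (\<open>orthogonal_strong_law\<close>). The first is the strong law for the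
integrable variables \<open>V\<^sub>k\<^sup>2\<close> (\<open>strong_law_nonneg\<close>): truncation at a constant reduces it to the
orthogonal case, and the tail is controlled by the crude bound
\<open>eventually_average_le_twice_mean\<close>.

Everything else is deterministic. Both recursions of the model are stable filters, and a stable
filter preserves three properties of its input: bounded power, growth slower than
\<open>sqrt n\<close>, and asymptotic orthogonality of all its lags to \<open>V\<close>. Hence \<open>V\<close> is asymptotically
orthogonal to the past of \<open>X\<close>, and shifting two lags of \<open>X\<close> simultaneously does not change
their inner product in the limit (the Toeplitz property).

Eliminating \<open>\<epsilon>\<close> turns the model into an autoregression of order \<open>p + 1\<close> whose last
coefficient is \<open>- \<kappa>\<close>, where \<open>\<kappa> = \<theta>\<^sub>p \<rho>\<close>. The vector \<open>\<theta>*\<close> is exactly the one for which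
\<open>V = fwd + \<kappa> * bwd\<close>, where \<open>fwd\<close> is the residual of predicting \<open>X\<^sub>k\<close> from
\<open>X\<^sub>k\<^sub>-\<^sub>1, \<dots>, X\<^sub>k\<^sub>-\<^sub>p\<close> with coefficients \<open>\<theta>*\<close> and \<open>bwd\<close> is its time reversal, the residual of
\<open>X\<^sub>k\<^sub>-\<^sub>p\<^sub>-\<^sub>1\<close>; this is one step of the Levinson recursion. Put
\<open>g\<^sub>j = ip n fwd (lag j X)\<close>. Since \<open>V\<close> is orthogonal to the past and the Toeplitz property allows
time reversal, \<open>g\<^sub>j\<close> is asymptotically \<open>- \<kappa> g\<^sub>p\<^sub>+\<^sub>1\<^sub>-\<^sub>j\<close> for \<open>1 \<le> j \<le> p + 1\<close>. Applying this twice
and using \<open>\<bar>\<kappa>\<bar> < 1\<close> gives \<open>g\<^sub>j \<longlonglongrightarrow> 0\<close> for \<open>1 \<le> j \<le> p\<close>, the normal equations of \<open>\<theta>*\<close>, while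
\<open>g\<^sub>p\<^sub>+\<^sub>1\<close> is asymptotically \<open>- \<kappa> g\<^sub>0\<close>. So the lag-one autocovariance of \<open>fwd\<close> is asymptotically
\<open>\<kappa> \<theta>*\<^sub>p\<close> times its power, and this factor is \<open>\<rho>*\<close>.

It remains to replace \<open>\<theta>*\<close> by the least squares estimator. The normal equations bound the power
of the difference of the two predictors (\<open>pred_err_power_le\<close>), and a linear predictor of small
power has small coefficients because testing it against \<open>V\<^sub>k\<^sub>-\<^sub>1, \<dots>, V\<^sub>k\<^sub>-\<^sub>p\<close> gives a triangular
system with diagonal \<open>\<sigma>\<^sup>2\<close> (\<open>coefficients_vanish\<close>). The Durbin-Watson numerator is then
asymptotically \<open>2 (1 - \<rho>*)\<close> times the denominator, and the denominator stays away from \<open>0\<close>.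
\<close>

section \<open>Strong laws of large numbers\<close>

text \<open>
By monotone convergence the series of the \<open>f n\<close> has a finite integral, so it converges almost
everywhere. This serves as a moment version of the Borel-Cantelli lemma.
\<close>
lemma summable_expectation_AE_tendsto_0:
  fixes f :: "nat \<Rightarrow> 'a \<Rightarrow> real"
  assumes int: "\<And>n. integrable M (f n)" and nonneg: "\<And>n x. 0 \<le> f n x"
    and summ: "summable (\<lambda>n. integral\<^sup>L M (f n))"
  shows "AE x in M. (\<lambda>n. f n x) \<longlonglongrightarrow> 0"
proof -
  have f_meas[measurable]: "f n \<in> borel_measurable M" for n
    by (rule borel_measurable_integrable[OF int])
  have "(\<integral>\<^sup>+x. (\<Sum>n. ennreal (f n x)) \<partial>M) = (\<Sum>n. \<integral>\<^sup>+x. ennreal (f n x) \<partial>M)"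
    by (rule nn_integral_suminf) measurable
  also have "\<dots> = (\<Sum>n. ennreal (integral\<^sup>L M (f n)))"
    by (rule suminf_cong, rule nn_integral_eq_integral[OF int]) (simp add: nonneg)
  also have "\<dots> = ennreal (\<Sum>n. integral\<^sup>L M (f n))"
    by (rule suminf_ennreal2[OF _ summ]) (simp add: nonneg)
  finally have "(\<integral>\<^sup>+x. (\<Sum>n. ennreal (f n x)) \<partial>M) \<noteq> \<infinity>" by simp
  then have "AE x in M. (\<Sum>n. ennreal (f n x)) \<noteq> \<infinity>"
    by (rule nn_integral_noteq_infinite[rotated]) measurable
  then show ?thesis
  proof (rule AE_mp, intro AE_I2 impI)
    fix x assume "(\<Sum>n. ennreal (f n x)) \<noteq> \<infinity>"
    then have "summable (\<lambda>n. f n x)"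
      by (intro summable_suminf_not_top[OF nonneg]) simp
    then show "(\<lambda>n. f n x) \<longlonglongrightarrow> 0" by (rule summable_LIMSEQ_zero)
  qed
qed

lemma integrable_mult_of_squares:
  fixes f g :: "'a \<Rightarrow> real"
  assumes [measurable]: "f \<in> borel_measurable M" "g \<in> borel_measurable M"
    and "integrable M (\<lambda>x. (f x)\<^sup>2)" "integrable M (\<lambda>x. (g x)\<^sup>2)"
  shows "integrable M (\<lambda>x. f x * g x)"
proof (rule Bochner_Integration.integrable_bound)
  show "integrable M (\<lambda>x. (f x)\<^sup>2 + (g x)\<^sup>2)" using assms by simp
  have "\<bar>a * b\<bar> \<le> a\<^sup>2 + b\<^sup>2" for a b :: real
  proof -
    have "2 * (\<bar>a\<bar> * \<bar>b\<bar>) \<le> a\<^sup>2 + b\<^sup>2"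
      using sum_squares_bound[of "\<bar>a\<bar>" "\<bar>b\<bar>"] by simp
    moreover have "0 \<le> \<bar>a\<bar> * \<bar>b\<bar>" by simp
    ultimately show ?thesis unfolding abs_mult by linarith
  qed
  then show "AE x in M. norm (f x * g x) \<le> norm ((f x)\<^sup>2 + (g x)\<^sup>2)" by simp
qed auto

lemma
  fixes Z :: "'i \<Rightarrow> 'a \<Rightarrow> real"
  assumes fin: "finite A" and Z_meas: "\<And>k. k \<in> A \<Longrightarrow> Z k \<in> borel_measurable M"
    and Z_sq: "\<And>k. k \<in> A \<Longrightarrow> integrable M (\<lambda>x. (Z k x)\<^sup>2)"
  shows integrable_sum_squared: "integrable M (\<lambda>x. (\<Sum>k\<in>A. Z k x)\<^sup>2)"
    and integral_sum_squared_orthogonal: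
      "(\<And>k l. k \<in> A \<Longrightarrow> l \<in> A \<Longrightarrow> k \<noteq> l \<Longrightarrow> (\<integral>x. Z k x * Z l x \<partial>M) = 0) \<Longrightarrow>
        (\<integral>x. (\<Sum>k\<in>A. Z k x)\<^sup>2 \<partial>M) = (\<Sum>k\<in>A. \<integral>x. (Z k x)\<^sup>2 \<partial>M)"
proof -
  have eq: "(\<lambda>x. (\<Sum>k\<in>A. Z k x)\<^sup>2) = (\<lambda>x. \<Sum>k\<in>A. \<Sum>l\<in>A. Z k x * Z l x)"
    by (simp add: power2_eq_square sum_product)
  have int: "integrable M (\<lambda>x. Z k x * Z l x)" if "k \<in> A" "l \<in> A" for k l
    using that by (intro integrable_mult_of_squares Z_meas Z_sq)
  show "integrable M (\<lambda>x. (\<Sum>k\<in>A. Z k x)\<^sup>2)"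
    unfolding eq by (intro Bochner_Integration.integrable_sum int)
  assume orth: "\<And>k l. k \<in> A \<Longrightarrow> l \<in> A \<Longrightarrow> k \<noteq> l \<Longrightarrow> (\<integral>x. Z k x * Z l x \<partial>M) = 0"
  have "(\<integral>x. (\<Sum>k\<in>A. Z k x)\<^sup>2 \<partial>M) = (\<Sum>k\<in>A. \<integral>x. (\<Sum>l\<in>A. Z k x * Z l x) \<partial>M)"
    unfolding eq by (intro Bochner_Integration.integral_sum Bochner_Integration.integrable_sum int)
  also have "\<dots> = (\<Sum>k\<in>A. \<Sum>l\<in>A. \<integral>x. Z k x * Z l x \<partial>M)"
    by (intro sum.cong refl Bochner_Integration.integral_sum int)
  also have "\<dots> = (\<Sum>k\<in>A. \<Sum>l\<in>A. if l = k then \<integral>x. (Z k x)\<^sup>2 \<partial>M else 0)"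
    by (intro sum.cong refl) (auto simp: orth power2_eq_square)
  also have "\<dots> = (\<Sum>k\<in>A. \<integral>x. (Z k x)\<^sup>2 \<partial>M)"
    using fin by simp
  finally show "(\<integral>x. (\<Sum>k\<in>A. Z k x)\<^sup>2 \<partial>M) = (\<Sum>k\<in>A. \<integral>x. (Z k x)\<^sup>2 \<partial>M)" .
qed

text \<open>
The averages are controlled along the squares \<open>m\<^sup>2\<close>, where their second moments \<open>C / m\<^sup>2\<close> are
summable. Between consecutive squares there are only \<open>2 m + 1\<close> terms, and the Cauchy-Schwarz
inequality bounds the second moment of the sum of their absolute values by a multiple of \<open>m\<^sup>2\<close>,
which is again summable after division by \<open>m\<^sup>4\<close>.
\<close>
theorem orthogonal_strong_law:
  fixes Z :: "nat \<Rightarrow> 'a \<Rightarrow> real"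
  assumes Z_meas[measurable]: "\<And>k. Z k \<in> borel_measurable M"
    and Z_sq: "\<And>k. integrable M (\<lambda>x. (Z k x)\<^sup>2)"
    and Z_bound: "\<And>k. (\<integral>x. (Z k x)\<^sup>2 \<partial>M) \<le> C"
    and orth: "\<And>k l. k \<noteq> l \<Longrightarrow> (\<integral>x. Z k x * Z l x \<partial>M) = 0"
  shows "AE x in M. (\<lambda>n. (\<Sum>k<n. Z k x) / n) \<longlonglongrightarrow> 0"
proof -
  define A where "A m x = ((\<Sum>k<m\<^sup>2. Z k x) / (real m)\<^sup>2)\<^sup>2" for m x
  define G where "G m x = (\<Sum>k\<in>{m\<^sup>2..<(Suc m)\<^sup>2}. \<bar>Z k x\<bar>)" for m x
  define B where "B m x = (2 * real m + 1) / (real m)^4 * (\<Sum>k\<in>{m\<^sup>2..<(Suc m)\<^sup>2}. (Z k x)\<^sup>2)" for m x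
  have card: "card {m\<^sup>2..<(Suc m)\<^sup>2} = 2 * m + 1" for m :: nat
    by (simp add: power2_eq_square)
  have C0: "0 \<le> C" using Z_bound[of 0] by (rule order_trans[rotated]) simp
  have GB: "(G m x / (real m)\<^sup>2)\<^sup>2 \<le> B m x" for m x
  proof -
    \<comment> \<open>Cauchy-Schwarz over the \<open>2 m + 1\<close> indices of the block\<close>
    have "(G m x)\<^sup>2 \<le> (\<Sum>k\<in>{m\<^sup>2..<(Suc m)\<^sup>2}. \<bar>Z k x\<bar>\<^sup>2) * real (card {m\<^sup>2..<(Suc m)\<^sup>2})"
      unfolding G_def by (rule sum_squared_le_sum_of_squares)
    then have "(G m x)\<^sup>2 \<le> (2 * real m + 1) * (\<Sum>k\<in>{m\<^sup>2..<(Suc m)\<^sup>2}. (Z k x)\<^sup>2)"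
      unfolding card by (simp add: algebra_simps)
    then have "(G m x)\<^sup>2 / (real m)^4 \<le> (2 * real m + 1) * (\<Sum>k\<in>{m\<^sup>2..<(Suc m)\<^sup>2}. (Z k x)\<^sup>2) / (real m)^4"
      by (rule divide_right_mono) simp
    then show ?thesis unfolding B_def by (simp add: power_divide flip: power_mult)
  qed
  have "AE x in M. (\<lambda>m. A m x) \<longlonglongrightarrow> 0"
  proof (rule summable_expectation_AE_tendsto_0)
    show intA: "integrable M (A m)" for m
      unfolding A_def power_divide by (intro integrable_divide integrable_sum_squared Z_sq) auto
    show "0 \<le> A m x" for m x unfolding A_def by simp
    show "summable (\<lambda>m. integral\<^sup>L M (A m))"
    proof (rule summable_comparison_test')
      show "summable (\<lambda>m. C * (1 / (real m)^2))"
        using inverse_power_summable[of 2, where 'a=real] by (intro summable_mult) (simp add: inverse_eq_divide)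
      fix m :: nat assume "m \<ge> 0"
      have "integral\<^sup>L M (A m) = (\<Sum>k<m\<^sup>2. \<integral>x. (Z k x)\<^sup>2 \<partial>M) / (real m)^4"
        unfolding A_def power_divide using Z_sq orth
        by (subst integral_divide_zero, subst integral_sum_squared_orthogonal) (auto simp flip: power_mult)
      also have "\<dots> \<le> (\<Sum>k<m\<^sup>2. C) / (real m)^4"
        by (intro divide_right_mono sum_mono Z_bound) simp
      also have "\<dots> = C * (1 / (real m)^2)"
        by (cases "m = 0") (simp_all add: field_simps power2_eq_square power4_eq_xxxx)
      finally have "integral\<^sup>L M (A m) \<le> C * (1 / (real m)^2)" .
      moreover have "0 \<le> integral\<^sup>L M (A m)" by (intro Bochner_Integration.integral_nonneg) (simp add: A_def)
      ultimately show "norm (integral\<^sup>L M (A m)) \<le> C * (1 / (real m)^2)" by simp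
    qed
  qed
  moreover have "AE x in M. (\<lambda>m. B m x) \<longlonglongrightarrow> 0"
  proof (rule summable_expectation_AE_tendsto_0)
    show intB: "integrable M (B m)" for m
      unfolding B_def by (intro integrable_mult_right Bochner_Integration.integrable_sum Z_sq)
    show B0: "0 \<le> B m x" for m x unfolding B_def by (intro mult_nonneg_nonneg sum_nonneg) auto
    \<comment> \<open>the factor \<open>9\<close> comes from \<open>2 m + 1 \<le> 3 m\<close>, which needs \<open>m \<ge> 1\<close>\<close>
    show "summable (\<lambda>m. integral\<^sup>L M (B m))"
    proof (rule summable_comparison_test')
      show "summable (\<lambda>m. 9 * C * (1 / (real m)^2))"
        using inverse_power_summable[of 2, where 'a=real] by (intro summable_mult) (simp add: inverse_eq_divide)
      fix m :: nat assume "m \<ge> 1"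
      have "integral\<^sup>L M (B m) = (2 * real m + 1) / (real m)^4 * (\<Sum>k\<in>{m\<^sup>2..<(Suc m)\<^sup>2}. \<integral>x. (Z k x)\<^sup>2 \<partial>M)"
        unfolding B_def by (subst integral_mult_right_zero, subst Bochner_Integration.integral_sum) (auto intro: Z_sq)
      also have "\<dots> \<le> (2 * real m + 1) / (real m)^4 * (\<Sum>k\<in>{m\<^sup>2..<(Suc m)\<^sup>2}. C)"
        by (intro mult_left_mono sum_mono Z_bound) simp
      also have "\<dots> = C * (2 * real m + 1)\<^sup>2 / (real m)^4"
        by (simp only: sum_constant card) (simp add: power2_eq_square)
      also have "\<dots> \<le> C * (3 * real m)\<^sup>2 / (real m)^4"
        using \<open>m \<ge> 1\<close> C0 by (intro divide_right_mono mult_left_mono power_mono) auto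
      also have "\<dots> = 9 * C * (1 / (real m)^2)"
        using \<open>m \<ge> 1\<close> by (simp add: field_simps power2_eq_square power4_eq_xxxx)
      finally have "integral\<^sup>L M (B m) \<le> 9 * C * (1 / (real m)^2)" .
      moreover have "0 \<le> integral\<^sup>L M (B m)"
        by (intro Bochner_Integration.integral_nonneg B0)
      ultimately show "norm (integral\<^sup>L M (B m)) \<le> 9 * C * (1 / (real m)^2)" by simp
    qed
  qed
  ultimately show ?thesis
  proof eventually_elim
    fix x assume A: "(\<lambda>m. A m x) \<longlonglongrightarrow> 0" and B: "(\<lambda>m. B m x) \<longlonglongrightarrow> 0"
    define H where "H m = sqrt (A m x) + sqrt (B m x)" for m
    have "H \<longlonglongrightarrow> 0"
      unfolding H_def using tendsto_add[OF tendsto_real_sqrt[OF A] tendsto_real_sqrt[OF B]] by simp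
    moreover have "filterlim floor_sqrt at_top sequentially"
      unfolding filterlim_at_top
    proof
      fix Z show "\<forall>\<^sub>F n in sequentially. Z \<le> floor_sqrt n"
        by (rule eventually_sequentiallyI[of "Z\<^sup>2"], rule le_floor_sqrtI)
    qed
    ultimately have lim: "(\<lambda>n. H (floor_sqrt n)) \<longlonglongrightarrow> 0"
      by (rule filterlim_compose)
    show "(\<lambda>n. (\<Sum>k<n. Z k x) / n) \<longlonglongrightarrow> 0"
    proof (rule Lim_null_comparison[OF _ lim], rule eventually_sequentiallyI[of 1])
      fix n :: nat assume "n \<ge> 1"
      define m where "m = floor_sqrt n"
      have m: "m\<^sup>2 \<le> n" "n < (Suc m)\<^sup>2"
        unfolding m_def by (simp_all add: Suc_floor_sqrt_power2_gt)
      have "m \<ge> 1" using m \<open>n \<ge> 1\<close> by (cases m) auto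
      have "\<bar>\<Sum>k<n. Z k x\<bar> = \<bar>(\<Sum>k<m\<^sup>2. Z k x) + (\<Sum>k\<in>{m\<^sup>2..<n}. Z k x)\<bar>"
        using sum.atLeastLessThan_concat[of 0 "m\<^sup>2" n "\<lambda>k. Z k x"] m(1)
        by (simp only: atLeast0LessThan)
      also have "\<dots> \<le> \<bar>\<Sum>k<m\<^sup>2. Z k x\<bar> + (\<Sum>k\<in>{m\<^sup>2..<n}. \<bar>Z k x\<bar>)"
        using sum_abs[of "\<lambda>k. Z k x" "{m\<^sup>2..<n}"] by linarith
      also have "(\<Sum>k\<in>{m\<^sup>2..<n}. \<bar>Z k x\<bar>) \<le> G m x"
        unfolding G_def using m(2) by (intro sum_mono2) auto
      finally have 1: "\<bar>\<Sum>k<n. Z k x\<bar> \<le> \<bar>\<Sum>k<m\<^sup>2. Z k x\<bar> + G m x" by simp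
      have "G m x \<ge> 0" unfolding G_def by (intro sum_nonneg) auto
      have "norm ((\<Sum>k<n. Z k x) / n) \<le> (\<bar>\<Sum>k<m\<^sup>2. Z k x\<bar> + G m x) / real n"
        using 1 by (simp add: divide_right_mono)
      also have "\<dots> \<le> (\<bar>\<Sum>k<m\<^sup>2. Z k x\<bar> + G m x) / (real m)\<^sup>2"
        using m(1) \<open>m \<ge> 1\<close> \<open>n \<ge> 1\<close> \<open>G m x \<ge> 0\<close>
        by (intro divide_left_mono) (auto simp flip: of_nat_power)
      also have "\<dots> = sqrt (A m x) + \<bar>G m x / (real m)\<^sup>2\<bar>"
        using \<open>G m x \<ge> 0\<close> by (simp add: A_def add_divide_distrib abs_divide)
      also have "\<dots> \<le> H m"
        unfolding H_def using GB[of m x] by (intro add_left_mono real_le_rsqrt) (simp add: power_divide)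
      finally show "norm ((\<Sum>k<n. Z k x) / n) \<le> H (floor_sqrt n)" unfolding m_def .
    qed
  qed
qed

text \<open>
The terms increase geometrically up to \<open>2 ^ m = y\<close> and decrease geometrically afterwards, so the
sum is of order \<open>y\<close>. The telescoping majorant \<open>g\<close>, which increases to \<open>6 * y\<close>, avoids splitting
the sum at this threshold.
\<close>
lemma sum_dyadic_truncation_le:
  fixes y :: real
  assumes "0 \<le> y"
  shows "(\<Sum>m<N. (min y (2 ^ m))\<^sup>2 / 2 ^ m) \<le> 6 * y"
proof -
  define g where "g m = 6 * 2 ^ m * y / (2 ^ m + y)" for m :: nat
  have step: "(min y (2 ^ m))\<^sup>2 / 2 ^ m \<le> g (Suc m) - g m" for m
  proof -
    define a :: real where "a = 2 ^ m"
    have a: "a > 0" by (simp add: a_def)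
    have pos: "2 * a + y > 0" "a + y > 0" using a assms by simp_all
    have "(min y a)\<^sup>2 * ((2 * a + y) * (a + y)) \<le> 6 * a\<^sup>2 * y\<^sup>2"
    proof (cases "y \<le> a")
      case True
      then have "(2 * a + y) * (a + y) \<le> (3 * a) * (2 * a)"
        using a assms by (intro mult_mono) auto
      then have "y\<^sup>2 * ((2 * a + y) * (a + y)) \<le> y\<^sup>2 * ((3 * a) * (2 * a))"
        by (rule mult_left_mono) simp
      then show ?thesis using True by (simp add: min_def power2_eq_square mult_ac)
    next
      case False
      then have "(2 * a + y) * (a + y) \<le> (3 * y) * (2 * y)"
        using a assms by (intro mult_mono) auto
      then have "a\<^sup>2 * ((2 * a + y) * (a + y)) \<le> a\<^sup>2 * ((3 * y) * (2 * y))"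
        by (rule mult_left_mono) simp
      then show ?thesis using False by (simp add: min_def power2_eq_square mult_ac)
    qed
    then have "(min y a)\<^sup>2 / a \<le> 6 * a * y\<^sup>2 / ((2 * a + y) * (a + y))"
      using a pos by (simp add: divide_simps power2_eq_square) (simp add: mult_ac)
    also have "\<dots> = 6 * (2 * a) * y / (2 * a + y) - 6 * a * y / (a + y)"
      using pos by (simp add: divide_simps) (simp add: algebra_simps power2_eq_square)
    finally show ?thesis by (simp add: g_def a_def)
  qed
  have "(\<Sum>m<N. (min y (2 ^ m))\<^sup>2 / 2 ^ m) \<le> (\<Sum>m<N. g (Suc m) - g m)"
    by (intro sum_mono step)
  also have "\<dots> = g N - g 0" by (rule sum_lessThan_telescope)
  also have "g 0 \<ge> 0" using assms by (simp add: g_def)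
  then have "g N - g 0 \<le> g N" by simp
  also have "g N \<le> 6 * y"
    using assms by (simp add: g_def divide_simps add_pos_nonneg) (simp add: algebra_simps)
  finally show ?thesis .
qed

text \<open>
Truncation makes the variables bounded, and pairwise independence makes their centred versions
orthogonal, so that second moment arguments apply.
\<close>
lemma (in prob_space) truncation_moments:
  fixes Y :: "nat \<Rightarrow> 'a \<Rightarrow> real" and c :: real
  assumes meas[measurable]: "\<And>k. random_variable borel (Y k)"
    and nonneg: "\<And>k x. 0 \<le> Y k x"
    and ident: "\<And>k. distr M borel (Y k) = distr M borel (Y 0)"
    and indep: "\<And>k l. k \<noteq> l \<Longrightarrow> indep_var borel (Y k) borel (Y l)"
    and c: "0 \<le> c"
  defines "T \<equiv> \<lambda>k x. min (Y k x) c" and "\<mu> \<equiv> expectation (\<lambda>x. min (Y 0 x) c)"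
  shows "integrable M (T k)" "integrable M (\<lambda>x. (T k x)\<^sup>2)"
    and "integrable M (\<lambda>x. (T k x - \<mu>)\<^sup>2)"
    and "expectation (\<lambda>x. (T k x)\<^sup>2) = expectation (\<lambda>x. (min (Y 0 x) c)\<^sup>2)"
    and "expectation (\<lambda>x. (T k x - \<mu>)\<^sup>2) \<le> expectation (\<lambda>x. (min (Y 0 x) c)\<^sup>2)"
    and "k \<noteq> l \<Longrightarrow> expectation (\<lambda>x. (T k x - \<mu>) * (T l x - \<mu>)) = 0"
proof -
  have [measurable]: "random_variable borel (T k)" for k unfolding T_def by measurable
  have T: "0 \<le> T k x" "T k x \<le> c" for k x using nonneg[of k x] c by (auto simp: T_def)
  have transfer: "expectation (\<lambda>x. f (Y k x)) = expectation (\<lambda>x. f (Y 0 x))"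
    if [measurable]: "f \<in> borel_measurable borel" for f :: "real \<Rightarrow> real" and k
    using integral_distr[of "Y k" M borel f] integral_distr[of "Y 0" M borel f] ident[of k] by simp
  show int: "integrable M (T k)" for k
    using T by (intro integrable_const_bound[of _ c]) auto
  show sq: "integrable M (\<lambda>x. (T k x)\<^sup>2)" for k
    using T by (intro integrable_const_bound[of _ "c\<^sup>2"]) (auto intro!: power_mono)
  show "integrable M (\<lambda>x. (T k x - \<mu>)\<^sup>2)"
    unfolding power2_diff using int sq by auto
  show ET2: "expectation (\<lambda>x. (T k x)\<^sup>2) = expectation (\<lambda>x. (min (Y 0 x) c)\<^sup>2)"
    using transfer[of "\<lambda>y. (min y c)\<^sup>2" k] by (simp add: T_def)
  have ET: "expectation (T k) = \<mu>" for k
    using transfer[of "\<lambda>y. min y c" k] by (simp add: T_def[abs_def] \<mu>_def)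
  have "expectation (\<lambda>x. (T k x - \<mu>)\<^sup>2) = expectation (\<lambda>x. (T k x)\<^sup>2) - \<mu>\<^sup>2"
    using variance_eq[OF int sq, of k] by (simp add: ET)
  then show "expectation (\<lambda>x. (T k x - \<mu>)\<^sup>2) \<le> expectation (\<lambda>x. (min (Y 0 x) c)\<^sup>2)"
    using ET2 by simp
  assume "k \<noteq> l"
  have "indep_var borel ((\<lambda>y. min y c - \<mu>) \<circ> Y k) borel ((\<lambda>y. min y c - \<mu>) \<circ> Y l)"
    by (rule indep_var_compose[OF indep[OF \<open>k \<noteq> l\<close>]]) measurable
  then have "indep_var borel (\<lambda>x. T k x - \<mu>) borel (\<lambda>x. T l x - \<mu>)"
    by (simp add: T_def comp_def)
  from indep_var_lebesgue_integral[OF this]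
  show "expectation (\<lambda>x. (T k x - \<mu>) * (T l x - \<mu>)) = 0"
    using int by (simp add: ET prob_space)
qed

text \<open>
Along \<open>n = 2 ^ m\<close> the variables are truncated at level \<open>2 ^ m\<close>. The expectation \<open>H m\<close> of the
squared truncation, divided by \<open>2 ^ m\<close>, bounds both the probability that some term with index below
\<open>2 ^ m\<close> exceeds the level and the variance of the average of the truncated terms; its sum over
\<open>m\<close> is finite by \<open>sum_dyadic_truncation_le\<close>. So the dyadic averages are eventually at most \<open>c\<close>,
and interpolating a nonnegative series between powers of two costs a factor \<open>2\<close>.
\<close>
lemma (in prob_space) eventually_average_le_twice_mean:
  fixes Y :: "nat \<Rightarrow> 'a \<Rightarrow> real"
  assumes meas[measurable]: "\<And>k. random_variable borel (Y k)"
    and nonneg: "\<And>k x. 0 \<le> Y k x"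
    and int: "integrable M (Y 0)"
    and ident: "\<And>k. distr M borel (Y k) = distr M borel (Y 0)"
    and indep: "\<And>k l. k \<noteq> l \<Longrightarrow> indep_var borel (Y k) borel (Y l)"
    and c: "expectation (Y 0) < c"
  shows "AE x in M. eventually (\<lambda>n. (\<Sum>k<n. Y k x) \<le> 2 * c * real n) sequentially"
proof -
  define T where "T m k x = min (Y k x) (2 ^ m)" for m k x
  define \<mu> where "\<mu> m = expectation (\<lambda>x. min (Y 0 x) (2 ^ m))" for m :: nat
  define H where "H m = expectation (\<lambda>x. (T m 0 x)\<^sup>2) / 2 ^ m" for m :: nat
  have scale: "0 \<le> (2::real) ^ m" for m :: nat by simp
  note mom = truncation_moments[where Y = Y, OF meas nonneg ident indep scale, folded \<mu>_def, folded T_def]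
  have [measurable]: "random_variable borel (T m k)" for m k unfolding T_def by measurable
  have EY0: "0 \<le> expectation (Y 0)" by (intro Bochner_Integration.integral_nonneg nonneg)
  have H0: "0 \<le> H m" for m
    unfolding H_def by (intro divide_nonneg_pos Bochner_Integration.integral_nonneg) auto
  have "summable H"
  proof (rule summableI_nonneg_bounded[OF H0])
    fix N
    have int2: "integrable M (\<lambda>x. (T m 0 x)\<^sup>2 / 2 ^ m)" for m :: nat
      by (intro integrable_divide mom(2))
    have "(\<Sum>m<N. H m) = expectation (\<lambda>x. \<Sum>m<N. (T m 0 x)\<^sup>2 / 2 ^ m)"
      unfolding H_def by (subst Bochner_Integration.integral_sum[OF int2]) simp
    also have "\<dots> \<le> expectation (\<lambda>x. 6 * Y 0 x)"
    proof (rule integral_mono)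
      show "integrable M (\<lambda>x. \<Sum>m<N. (T m 0 x)\<^sup>2 / 2 ^ m)"
        by (intro Bochner_Integration.integrable_sum int2)
      show "integrable M (\<lambda>x. 6 * Y 0 x)" using int by simp
      show "(\<Sum>m<N. (T m 0 x)\<^sup>2 / 2 ^ m) \<le> 6 * Y 0 x" for x
        unfolding T_def by (rule sum_dyadic_truncation_le[OF nonneg])
    qed
    finally show "(\<Sum>m<N. H m) \<le> 6 * expectation (Y 0)" by simp
  qed
  define F where "F m x = (\<Sum>k<2 ^ m. (T m k x)\<^sup>2) / 4 ^ m" for m x
  define G where "G m x = (\<Sum>k<2 ^ m. T m k x - \<mu> m)\<^sup>2 / 4 ^ m" for m x
  have four: "(4::real) ^ m = 2 ^ m * 2 ^ m" for m :: nat
    by (simp flip: power_mult_distrib)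
  have "AE x in M. (\<lambda>m. F m x) \<longlonglongrightarrow> 0"
  proof (rule summable_expectation_AE_tendsto_0)
    show "integrable M (F m)" for m
      unfolding F_def by (intro integrable_divide Bochner_Integration.integrable_sum mom(2))
    show "0 \<le> F m x" for m x unfolding F_def by (intro divide_nonneg_pos sum_nonneg) auto
    have "expectation (F m) = H m" for m
    proof -
      have "expectation (F m) = (\<Sum>k<2 ^ m. expectation (\<lambda>x. (T m k x)\<^sup>2)) / 4 ^ m"
        unfolding F_def by (simp add: Bochner_Integration.integral_sum mom(2))
      also have "\<dots> = (\<Sum>k<(2::nat) ^ m. expectation (\<lambda>x. (T m 0 x)\<^sup>2)) / 4 ^ m"
        by (intro arg_cong2[where f = "(/)"] sum.cong refl mom(4))
      also have "\<dots> = H m" by (simp add: H_def four)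
      finally show ?thesis .
    qed
    then show "summable (\<lambda>m. expectation (F m))" using \<open>summable H\<close> by simp
  qed
  moreover have "AE x in M. (\<lambda>m. G m x) \<longlonglongrightarrow> 0"
  proof (rule summable_expectation_AE_tendsto_0)
    show "integrable M (G m)" for m
      unfolding G_def by (intro integrable_divide integrable_sum_squared mom(3)) auto
    show G0: "0 \<le> G m x" for m x unfolding G_def by simp
    have "expectation (G m) \<le> H m" for m
    proof -
      have "expectation (G m) = (\<Sum>k<2 ^ m. expectation (\<lambda>x. (T m k x - \<mu> m)\<^sup>2)) / 4 ^ m"
        unfolding G_def using mom(3,6)
        by (subst integral_divide_zero, subst integral_sum_squared_orthogonal) auto
      also have "\<dots> \<le> (\<Sum>k<(2::nat) ^ m. expectation (\<lambda>x. (T m 0 x)\<^sup>2)) / 4 ^ m"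
        by (intro divide_right_mono sum_mono mom(5)) auto
      also have "\<dots> = H m" by (simp add: H_def four)
      finally show ?thesis .
    qed
    then show "summable (\<lambda>m. expectation (G m))"
      using \<open>summable H\<close> G0
      by (intro summable_comparison_test'[where f = "\<lambda>m. expectation (G m)" and g = H])
         (simp_all add: Bochner_Integration.integral_nonneg)
  qed
  ultimately show ?thesis
  proof eventually_elim
    fix x assume F: "(\<lambda>m. F m x) \<longlonglongrightarrow> 0" and G: "(\<lambda>m. G m x) \<longlonglongrightarrow> 0"
    define \<delta> where "\<delta> = c - expectation (Y 0)"
    have "\<delta> > 0" using c by (simp add: \<delta>_def)
    have "eventually (\<lambda>m. F m x < 1 \<and> G m x < \<delta>\<^sup>2) sequentially"
      using order_tendstoD(2)[OF F, of 1] order_tendstoD(2)[OF G, of "\<delta>\<^sup>2"] \<open>\<delta> > 0\<close>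
      by (simp add: eventually_conj)
    then obtain m0 where m0: "F m x < 1" "G m x < \<delta>\<^sup>2" if "m \<ge> m0" for m
      unfolding eventually_sequentially by blast
    have dyadic: "(\<Sum>k<2 ^ m. Y k x) \<le> c * 2 ^ m" if "m \<ge> m0" for m
    proof -
      \<comment> \<open>\<open>F m x < 1\<close> prevents every truncation from reaching its level \<open>2 ^ m\<close>\<close>
      have "Y k x = T m k x" if "k < 2 ^ m" for k
      proof -
        have "(T m k x)\<^sup>2 \<le> (\<Sum>k<2 ^ m. (T m k x)\<^sup>2)"
          using that by (intro member_le_sum) auto
        also have "\<dots> < 4 ^ m"
          using m0(1)[OF \<open>m \<ge> m0\<close>] by (simp add: F_def divide_simps)
        also have "\<dots> = (2 ^ m)\<^sup>2" by (simp add: four power2_eq_square)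
        finally have "T m k x < 2 ^ m" by (rule power_less_imp_less_base) simp
        then show ?thesis by (auto simp: T_def min_def split: if_splits)
      qed
      then have "(\<Sum>k<2 ^ m. Y k x) = (\<Sum>k<2 ^ m. T m k x - \<mu> m) + 2 ^ m * \<mu> m"
        by (simp add: sum_subtractf)
      moreover have "(\<Sum>k<2 ^ m. T m k x - \<mu> m) \<le> \<delta> * 2 ^ m"
      proof (rule power2_le_imp_le)
        show "(\<Sum>k<2 ^ m. T m k x - \<mu> m)\<^sup>2 \<le> (\<delta> * 2 ^ m)\<^sup>2"
        proof -
          have "(\<Sum>k<2 ^ m. T m k x - \<mu> m)\<^sup>2 \<le> \<delta>\<^sup>2 * 4 ^ m"
            using m0(2)[OF \<open>m \<ge> m0\<close>] by (simp add: G_def divide_less_eq)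
          also have "\<dots> = (\<delta> * 2 ^ m)\<^sup>2"
            by (simp only: four power2_eq_square mult_ac)
          finally show ?thesis .
        qed
        show "0 \<le> \<delta> * 2 ^ m" using \<open>\<delta> > 0\<close> by simp
      qed
      moreover have "\<mu> m \<le> expectation (Y 0)"
        unfolding \<mu>_def using int mom(1)[where k=0] by (intro integral_mono) (auto simp: T_def[abs_def])
      then have "2 ^ m * \<mu> m \<le> 2 ^ m * expectation (Y 0)" by (rule mult_left_mono) simp
      ultimately have "(\<Sum>k<2 ^ m. Y k x) \<le> \<delta> * 2 ^ m + 2 ^ m * expectation (Y 0)" by linarith
      then show ?thesis by (simp add: \<delta>_def algebra_simps)
    qed
    show "eventually (\<lambda>n. (\<Sum>k<n. Y k x) \<le> 2 * c * real n) sequentially"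
    proof (rule eventually_sequentiallyI[of "2 ^ m0"])
      fix n :: nat assume n: "2 ^ m0 \<le> n"
      have "(1::nat) \<le> 2 ^ m0" by simp
      then have "1 \<le> n" using n by linarith
      then obtain m where m: "2 ^ m \<le> n" "n < 2 ^ (m + 1)"
        using ex_power_ivl1[of 2 n] by auto
      \<comment> \<open>the comparison uses the next power \<open>2 ^ (m + 1) > n\<close>, hence \<open>m + 1\<close> and not \<open>m\<close>\<close>
      have "(2::nat) ^ m0 < 2 ^ (m + 1)" using n m(2) by (rule le_less_trans)
      then have "m0 < m + 1" by (rule power_less_imp_less_exp[rotated]) simp
      then have "m0 \<le> m + 1" by simp
      have "(\<Sum>k<n. Y k x) \<le> (\<Sum>k<2 ^ (m + 1). Y k x)"
        using m(2) by (intro sum_mono2 nonneg) auto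
      also have "\<dots> \<le> c * 2 ^ (m + 1)" using \<open>m0 \<le> m + 1\<close> by (rule dyadic)
      also have "\<dots> = 2 * c * real (2 ^ m)" by simp
      also have "\<dots> \<le> 2 * c * real n"
        using m(1) c EY0 by (intro mult_left_mono of_nat_mono) auto
      finally show "(\<Sum>k<n. Y k x) \<le> 2 * c * real n" .
    qed
  qed
qed

text \<open>
Each variable is the sum of its truncation at \<open>N\<close>, which obeys the law for orthogonal variables, and
of an excess, whose averages are eventually at most about twice its mean. That mean vanishes as
\<open>N\<close> grows, which absorbs the factor \<open>2\<close>.
\<close>
theorem (in prob_space) strong_law_nonneg:
  fixes Y :: "nat \<Rightarrow> 'a \<Rightarrow> real"
  assumes meas[measurable]: "\<And>k. random_variable borel (Y k)"
    and nonneg: "\<And>k x. 0 \<le> Y k x"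
    and int: "integrable M (Y 0)"
    and ident: "\<And>k. distr M borel (Y k) = distr M borel (Y 0)"
    and indep: "\<And>k l. k \<noteq> l \<Longrightarrow> indep_var borel (Y k) borel (Y l)"
  shows "AE x in M. (\<lambda>n. (\<Sum>k<n. Y k x) / real n) \<longlonglongrightarrow> expectation (Y 0)"
proof -
  define \<mu> where "\<mu> N = expectation (\<lambda>x. min (Y 0 x) (real N))" for N
  define Z where "Z N k x = min (Y k x) (real N) - \<mu> N" for N k x
  define R where "R N k x = Y k x - min (Y k x) (real N)" for N k x
  \<comment> \<open>the summand \<open>1 / (N + 1)\<close> makes \<open>c N\<close> strictly larger than the mean of the excess\<close>
  define c where "c N = (expectation (Y 0) - \<mu> N) + 1 / (real N + 1)" for N
  have scale: "0 \<le> real N" for N by simp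
  note mom = truncation_moments[where Y = Y, OF meas nonneg ident indep scale, folded \<mu>_def]
  have "AE x in M. (\<lambda>n. (\<Sum>k<n. Z N k x) / real n) \<longlonglongrightarrow> 0" for N
  proof (rule orthogonal_strong_law)
    show "Z N k \<in> borel_measurable M" for k unfolding Z_def by measurable
    show "integrable M (\<lambda>x. (Z N k x)\<^sup>2)" for k
      unfolding Z_def by (rule mom(3))
    show "expectation (\<lambda>x. (Z N k x)\<^sup>2) \<le> expectation (\<lambda>x. (min (Y 0 x) (real N))\<^sup>2)" for k
      unfolding Z_def by (rule mom(5))
    show "expectation (\<lambda>x. Z N k x * Z N l x) = 0" if "k \<noteq> l" for k l
      unfolding Z_def by (rule mom(6)) (use that in auto)
  qed
  moreover have "AE x in M. eventually (\<lambda>n. (\<Sum>k<n. R N k x) \<le> 2 * c N * real n) sequentially" for N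
  proof (rule eventually_average_le_twice_mean)
    show "random_variable borel (R N k)" for k unfolding R_def by measurable
    show "0 \<le> R N k x" for k x by (simp add: R_def)
    show "integrable M (R N 0)" unfolding R_def using int mom(1)[of 0] by auto
    have comp: "R N k = (\<lambda>y. y - min y (real N)) \<circ> Y k" for k by (simp add: R_def fun_eq_iff)
    show "distr M borel (R N k) = distr M borel (R N 0)" for k
      unfolding comp using ident[of k]
        distr_distr[of "\<lambda>y. y - min y (real N)" borel borel "Y k" M, symmetric]
        distr_distr[of "\<lambda>y. y - min y (real N)" borel borel "Y 0" M, symmetric] by simp
    show "indep_var borel (R N k) borel (R N l)" if "k \<noteq> l" for k l
      unfolding comp by (rule indep_var_compose[OF indep[OF that]]) measurable
    have "expectation (R N 0) = expectation (Y 0) - \<mu> N"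
      unfolding R_def \<mu>_def using int mom(1)[of 0] by (intro Bochner_Integration.integral_diff) auto
    then show "expectation (R N 0) < c N" by (simp add: c_def add_pos_nonneg)
  qed
  ultimately have "AE x in M. \<forall>N. (\<lambda>n. (\<Sum>k<n. Z N k x) / real n) \<longlonglongrightarrow> 0 \<and>
      eventually (\<lambda>n. (\<Sum>k<n. R N k x) \<le> 2 * c N * real n) sequentially"
    by (simp add: AE_all_countable)
  moreover have "c \<longlonglongrightarrow> 0"
  proof -
    have "\<mu> \<longlonglongrightarrow> expectation (Y 0)"
      unfolding \<mu>_def
    proof (rule integral_dominated_convergence[where w = "Y 0"])
      show "AE x in M. (\<lambda>N. min (Y 0 x) (real N)) \<longlonglongrightarrow> Y 0 x"
      proof (intro AE_I2 tendsto_eventually)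
        fix x
        show "eventually (\<lambda>N. min (Y 0 x) (real N) = Y 0 x) sequentially"
          by (rule eventually_sequentiallyI[of "nat \<lceil>Y 0 x\<rceil>"]) (simp add: min_def nat_ceiling_le_eq)
      qed
      show "AE x in M. norm (min (Y 0 x) (real N)) \<le> Y 0 x" for N
        using nonneg by (intro AE_I2) simp
    qed (use int in auto)
    then have "c \<longlonglongrightarrow> (expectation (Y 0) - expectation (Y 0)) + 0"
      unfolding c_def by (intro tendsto_add tendsto_diff tendsto_const LIMSEQ_inverse_real_of_nat[unfolded inverse_eq_divide of_nat_Suc add.commute[of 1]])
    then show ?thesis by simp
  qed
  ultimately show ?thesis
  proof (elim eventually_mono, intro LIMSEQ_I)
    fix x e
    assume lims: "\<forall>N. (\<lambda>n. (\<Sum>k<n. Z N k x) / real n) \<longlonglongrightarrow> 0 \<and>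
      eventually (\<lambda>n. (\<Sum>k<n. R N k x) \<le> 2 * c N * real n) sequentially" and "0 < (e::real)"
    have "eventually (\<lambda>N. c N < e / 4) sequentially"
      using \<open>c \<longlonglongrightarrow> 0\<close> \<open>0 < e\<close> by (intro order_tendstoD) auto
    then obtain N where N: "c N < e / 4" by (meson eventually_happens sequentially_bot)
    have mean: "0 \<le> expectation (Y 0) - \<mu> N"
      unfolding \<mu>_def using int mom(1)[of 0] by (auto intro: integral_mono)
    have "eventually (\<lambda>n. \<bar>(\<Sum>k<n. Z N k x) / real n\<bar> < e / 2) sequentially"
      using tendsto_rabs[OF lims[rule_format, THEN conjunct1, of N]] \<open>0 < e\<close> by (intro order_tendstoD) auto
    moreover have "eventually (\<lambda>n. (\<Sum>k<n. R N k x) \<le> 2 * c N * real n) sequentially"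
      using lims by blast
    ultimately have "eventually (\<lambda>n. norm ((\<Sum>k<n. Y k x) / real n - expectation (Y 0)) < e) sequentially"
      using eventually_gt_at_top[of 0]
    proof eventually_elim
      case (elim n)
      have "(\<Sum>k<n. Y k x) = (\<Sum>k<n. Z N k x) + (\<Sum>k<n. R N k x) + real n * \<mu> N"
        by (simp add: Z_def R_def sum_subtractf)
      then have eq: "(\<Sum>k<n. Y k x) / real n = (\<Sum>k<n. Z N k x) / real n + (\<Sum>k<n. R N k x) / real n + \<mu> N"
        using elim(3) by (simp add: field_simps)
      have "(\<Sum>k<n. R N k x) / real n \<le> 2 * c N" using elim(2,3) by (simp add: divide_simps)
      moreover have "0 \<le> (\<Sum>k<n. R N k x) / real n"
        by (intro divide_nonneg_nonneg sum_nonneg) (auto simp: R_def)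
      moreover have "expectation (Y 0) - \<mu> N \<le> c N" by (simp add: c_def)
      ultimately show ?case using eq elim(1) N mean unfolding real_norm_def by arith
    qed
    then show "\<exists>no. \<forall>n\<ge>no. norm ((\<Sum>k<n. Y k x) / real n - expectation (Y 0)) < e"
      by (simp add: eventually_sequentially)
  qed
qed

lemma (in prob_space) indep_var_of_indep_vars:
  fixes f g :: "real \<Rightarrow> real"
  assumes "indep_vars (\<lambda>_. borel) V I" "k \<in> I" "l \<in> I" "k \<noteq> l"
    and [measurable]: "f \<in> borel_measurable borel" "g \<in> borel_measurable borel"
  shows "indep_var borel (\<lambda>x. f (V k x)) borel (\<lambda>x. g (V l x))"
proof -
  have "indep_var (PiM {k} (\<lambda>_. borel)) (\<lambda>x. restrict (\<lambda>i. V i x) {k})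
      (PiM {l} (\<lambda>_. borel)) (\<lambda>x. restrict (\<lambda>i. V i x) {l})"
    using assms(2-4) by (intro indep_var_restrict[OF assms(1)]) auto
  from indep_var_compose[OF this, of "\<lambda>h. f (h k)" borel "\<lambda>h. g (h l)" borel]
  show ?thesis by (simp add: comp_def)
qed

text \<open>
The largest index \<open>k + j\<close> occurs only once among the four, so the centred factor \<open>V (k + j)\<close> splits
off. The other three indices are distinct unless \<open>l + j = k\<close>, when \<open>V k\<close> appears squared.
\<close>
lemma (in prob_space) expectation_lagged_products:
  fixes V :: "nat \<Rightarrow> 'a \<Rightarrow> real"
  assumes indep: "indep_vars (\<lambda>_. borel) V {1..}"
    and sq: "\<And>k. k \<ge> 1 \<Longrightarrow> integrable M (\<lambda>x. (V k x)\<^sup>2)"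
    and mean: "\<And>k. k \<ge> 1 \<Longrightarrow> expectation (V k) = 0"
    and "1 \<le> j" "1 \<le> l" "l < k"
  shows "expectation (\<lambda>x. (V (k + j) x * V k x) * (V (l + j) x * V l x)) = 0"
proof -
  have meas: "random_variable borel (V k)" if "k \<ge> 1" for k
    using indep that by (simp add: indep_vars_def)
  have int: "integrable M (V k)" if "k \<ge> 1" for k
    by (rule square_integrable_imp_integrable[OF meas sq]) (use that in auto)
  have zero: "expectation (\<lambda>x. \<Prod>i\<in>I. F i (V i x)) = 0"
    if "finite I" "I \<subseteq> {1..}" "k + j \<in> I" "F (k + j) = (\<lambda>y. y)" "\<And>i. F i = (\<lambda>y. y) \<or> F i = (\<lambda>y. y\<^sup>2)" for I F
  proof -
    have [measurable]: "F i \<in> borel_measurable borel" for i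
      using that(5)[of i] by auto
    have "indep_vars (\<lambda>_. borel) (\<lambda>i x. F i (V i x)) I"
      by (rule indep_vars_compose2[OF indep_vars_subset[OF indep that(2)]]) auto
    moreover have "integrable M (\<lambda>x. F i (V i x))" if "i \<in> I" for i
      using \<open>I \<subseteq> {1..}\<close> that \<open>\<And>i. F i = (\<lambda>y. y) \<or> F i = (\<lambda>y. y\<^sup>2)\<close>[of i] int[of i] sq[of i] by auto
    ultimately have "expectation (\<lambda>x. \<Prod>i\<in>I. F i (V i x)) = (\<Prod>i\<in>I. expectation (\<lambda>x. F i (V i x)))"
      by (intro indep_vars_lebesgue_integral that(1))
    also have "\<dots> = 0"
      using that(1,3,4) mean[of "k + j"] \<open>1 \<le> j\<close> by (intro prod_zero) (auto intro!: bexI[of _ "k + j"])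
    finally show ?thesis .
  qed
  show ?thesis
  proof (cases "l + j = k")
    case True
    then have "(\<lambda>x. (V (k + j) x * V k x) * (V (l + j) x * V l x)) =
        (\<lambda>x. \<Prod>i\<in>{k + j, k, l}. (if i = k then \<lambda>y. y\<^sup>2 else (\<lambda>y. y)) (V i x))"
      using assms(4-6) by (auto simp: power2_eq_square)
    then show ?thesis using zero[of "{k + j, k, l}" "\<lambda>i. if i = k then \<lambda>y. y\<^sup>2 else (\<lambda>y. y)"] assms(4-6)
      by auto
  next
    case False
    then have "(\<lambda>x. (V (k + j) x * V k x) * (V (l + j) x * V l x)) =
        (\<lambda>x. \<Prod>i\<in>{k + j, k, l + j, l}. V i x)"
      using assms(4-6) by auto
    then show ?thesis using zero[of "{k + j, k, l + j, l}" "\<lambda>i y. y"] assms(4-6) by auto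
  qed
qed

theorem (in prob_space) strong_law_lagged_products:
  fixes V :: "nat \<Rightarrow> 'a \<Rightarrow> real"
  assumes indep: "indep_vars (\<lambda>_. borel) V {1..}"
    and sq: "\<And>k. k \<ge> 1 \<Longrightarrow> integrable M (\<lambda>x. (V k x)\<^sup>2)"
    and mean: "\<And>k. k \<ge> 1 \<Longrightarrow> expectation (V k) = 0"
    and var: "\<And>k. k \<ge> 1 \<Longrightarrow> expectation (\<lambda>x. (V k x)\<^sup>2) = s"
    and "1 \<le> j"
  shows "AE x in M. (\<lambda>n. (\<Sum>k<n. V (Suc k + j) x * V (Suc k) x) / real n) \<longlonglongrightarrow> 0"
proof (rule orthogonal_strong_law)
  have [measurable]: "random_variable borel (V k)" if "k \<ge> 1" for k
    using indep that by (simp add: indep_vars_def)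
  show "random_variable borel (\<lambda>x. V (Suc k + j) x * V (Suc k) x)" for k by measurable
  have iv: "indep_var borel (\<lambda>x. (V (Suc k + j) x)\<^sup>2) borel (\<lambda>x. (V (Suc k) x)\<^sup>2)" for k
    using \<open>1 \<le> j\<close> by (intro indep_var_of_indep_vars[OF indep]) auto
  show "integrable M (\<lambda>x. (V (Suc k + j) x * V (Suc k) x)\<^sup>2)" for k
    unfolding power_mult_distrib by (rule indep_var_integrable[OF iv]) (simp_all add: sq)
  have "expectation (\<lambda>x. (V (Suc k + j) x)\<^sup>2 * (V (Suc k) x)\<^sup>2) = s * s" for k
    by (subst indep_var_lebesgue_integral[OF iv]) (simp_all add: sq var)
  then show "expectation (\<lambda>x. (V (Suc k + j) x * V (Suc k) x)\<^sup>2) \<le> s * s" for k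
    unfolding power_mult_distrib by simp
  show "expectation (\<lambda>x. V (Suc k + j) x * V (Suc k) x * (V (Suc l + j) x * V (Suc l) x)) = 0"
    if "k \<noteq> l" for k l
  proof (cases "l < k")
    case True
    then show ?thesis
      using expectation_lagged_products[OF indep sq mean \<open>1 \<le> j\<close>, of "Suc l" "Suc k"] by simp
  next
    case False
    then show ?thesis
      using expectation_lagged_products[OF indep sq mean \<open>1 \<le> j\<close>, of "Suc k" "Suc l"] that
      by (simp add: mult_ac)
  qed
qed

section \<open>Sample inner products of two-sided sequences\<close>

definition lag :: "nat \<Rightarrow> (int \<Rightarrow> real) \<Rightarrow> int \<Rightarrow> real" where
  "lag i f = (\<lambda>k. f (k - int i))"

text \<open>
The sum has \<open>n + 1\<close> terms, but the divisor \<open>n\<close> has the same effect in the limit and matches the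
\<open>n\<close> residuals with indices \<open>1, \<dots>, n\<close>. At \<open>n = 0\<close> the value is \<open>0\<close>.
\<close>
definition ip :: "nat \<Rightarrow> (int \<Rightarrow> real) \<Rightarrow> (int \<Rightarrow> real) \<Rightarrow> real" where
  "ip n f g = (\<Sum>k\<le>n. f (int k) * g (int k)) / real n"

text \<open>
Extending all paths by \<open>0\<close> to negative times makes the recursions of the model hold at every
integer time and removes boundary terms at the left end of lagged sums.
\<close>
definition causal :: "(int \<Rightarrow> real) \<Rightarrow> bool" where
  "causal f \<longleftrightarrow> (\<forall>k<0. f k = 0)"

definition bounded_power :: "(int \<Rightarrow> real) \<Rightarrow> bool" where
  "bounded_power f \<longleftrightarrow> (\<exists>C. \<forall>n. ip n f f \<le> C)"

text \<open>
This is \<open>f n = o(sqrt n)\<close>, in a form that passes through recursions by induction on \<open>n\<close>.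
\<close>
definition slow :: "(int \<Rightarrow> real) \<Rightarrow> bool" where
  "slow f \<longleftrightarrow> (\<forall>\<delta>>0. \<exists>B. \<forall>n. \<bar>f (int n)\<bar> \<le> B + \<delta> * sqrt (real n))"

definition asymp_eq :: "(nat \<Rightarrow> real) \<Rightarrow> (nat \<Rightarrow> real) \<Rightarrow> bool" (infix "\<doteq>" 50) where
  "a \<doteq> b \<longleftrightarrow> (\<lambda>n. a n - b n) \<longlonglongrightarrow> 0"

lemma asymp_eq_refl [simp]: "a \<doteq> a"
  by (simp add: asymp_eq_def)

lemma asymp_eq_sym: "a \<doteq> b \<Longrightarrow> b \<doteq> a"
  unfolding asymp_eq_def using tendsto_minus[of "\<lambda>n. a n - b n" 0 sequentially] by simp

lemma asymp_eq_trans [trans]: "a \<doteq> b \<Longrightarrow> b \<doteq> c \<Longrightarrow> a \<doteq> c"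
  unfolding asymp_eq_def using tendsto_add[of "\<lambda>n. a n - b n" 0 sequentially "\<lambda>n. b n - c n" 0] by simp

lemma asymp_eq_zero: "a \<doteq> (\<lambda>_. 0) \<longleftrightarrow> a \<longlonglongrightarrow> 0"
  by (simp add: asymp_eq_def)

lemma asymp_eq_add: "a \<doteq> a' \<Longrightarrow> b \<doteq> b' \<Longrightarrow> (\<lambda>n. a n + b n) \<doteq> (\<lambda>n. a' n + b' n)"
  unfolding asymp_eq_def using tendsto_add[of "\<lambda>n. a n - a' n" 0 sequentially "\<lambda>n. b n - b' n" 0]
  by (simp add: algebra_simps)

lemma asymp_eq_diff: "a \<doteq> a' \<Longrightarrow> b \<doteq> b' \<Longrightarrow> (\<lambda>n. a n - b n) \<doteq> (\<lambda>n. a' n - b' n)"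
  unfolding asymp_eq_def using tendsto_diff[of "\<lambda>n. a n - a' n" 0 sequentially "\<lambda>n. b n - b' n" 0]
  by (simp add: algebra_simps)

lemma asymp_eq_cmult: "a \<doteq> a' \<Longrightarrow> (\<lambda>n. c * a n) \<doteq> (\<lambda>n. c * a' n)"
  unfolding asymp_eq_def using tendsto_mult_left[of "\<lambda>n. a n - a' n" 0 sequentially c]
  by (simp add: algebra_simps)

lemma asymp_eq_sum: "(\<And>i. i \<in> I \<Longrightarrow> a i \<doteq> b i) \<Longrightarrow> (\<lambda>n. \<Sum>i\<in>I. a i n) \<doteq> (\<lambda>n. \<Sum>i\<in>I. b i n)"
  unfolding asymp_eq_def sum_subtractf[symmetric] by (rule tendsto_null_sum)

lemma asymp_eq_tendsto: "a \<doteq> b \<Longrightarrow> b \<longlonglongrightarrow> l \<Longrightarrow> a \<longlonglongrightarrow> l"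
  unfolding asymp_eq_def using tendsto_add[of "\<lambda>n. a n - b n" 0 sequentially b l] by simp

lemma lag_lag: "lag i (lag j f) = lag (i + j) f"
  by (auto simp: lag_def algebra_simps)

lemma lag_0 [simp]: "lag 0 f = f"
  by (simp add: lag_def)

lemma causal_lag [intro]: "causal f \<Longrightarrow> causal (lag j f)"
  by (simp add: causal_def lag_def)

lemma causal_combination:
  "(\<And>i. i \<in> I \<Longrightarrow> causal (f i)) \<Longrightarrow> causal (\<lambda>k. \<Sum>i\<in>I. a i * f i k)"
  by (simp add: causal_def)

lemma ip_commute: "ip n f g = ip n g f"
  by (simp add: ip_def mult.commute)

lemma ip_diff_left: "ip n (\<lambda>k. f k - g k) h = ip n f h - ip n g h"
  by (simp add: ip_def sum_subtractf left_diff_distrib diff_divide_distrib)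

lemma ip_add_left: "ip n (\<lambda>k. f k + g k) h = ip n f h + ip n g h"
  by (simp add: ip_def sum.distrib distrib_right add_divide_distrib)

lemma ip_cmult_left: "ip n (\<lambda>k. c * f k) h = c * ip n f h"
  by (simp add: ip_def sum_distrib_left mult.assoc)

lemma ip_sum_left: "ip n (\<lambda>k. \<Sum>i\<in>I. a i * f i k) h = (\<Sum>i\<in>I. a i * ip n (f i) h)"
proof -
  have "(\<Sum>k\<le>n. (\<Sum>i\<in>I. a i * f i (int k)) * h (int k)) =
      (\<Sum>i\<in>I. a i * (\<Sum>k\<le>n. f i (int k) * h (int k)))"
    by (simp add: sum_distrib_right sum_distrib_left mult.assoc sum.swap[of _ I])
  then show ?thesis
    by (simp only: ip_def sum_divide_distrib[where A = I] times_divide_eq_right)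
qed

lemma ip_diff_right: "ip n h (\<lambda>k. f k - g k) = ip n h f - ip n h g"
  and ip_add_right: "ip n h (\<lambda>k. f k + g k) = ip n h f + ip n h g"
  and ip_cmult_right: "ip n h (\<lambda>k. c * f k) = c * ip n h f"
  and ip_sum_right: "ip n h (\<lambda>k. \<Sum>i\<in>I. a i * F i k) = (\<Sum>i\<in>I. a i * ip n h (F i))"
  by (simp_all only: ip_commute[of n h] ip_diff_left ip_add_left ip_cmult_left ip_sum_left)

lemma ip_nonneg: "0 \<le> ip n f f"
  by (simp add: ip_def sum_nonneg)

lemma ip_Cauchy_Schwarz: "\<bar>ip n f g\<bar> \<le> sqrt (ip n f f) * sqrt (ip n g g)"
proof -
  have "\<bar>\<Sum>k\<le>n. f (int k) * g (int k)\<bar> \<le> (\<Sum>k\<le>n. \<bar>f (int k)\<bar> * \<bar>g (int k)\<bar>)"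
    by (rule order_trans[OF sum_abs]) (simp add: abs_mult)
  also have "\<dots> \<le> L2_set (\<lambda>k. f (int k)) {..n} * L2_set (\<lambda>k. g (int k)) {..n}"
    by (rule L2_set_mult_ineq)
  finally have "\<bar>ip n f g\<bar> \<le> L2_set (\<lambda>k. f (int k)) {..n} * L2_set (\<lambda>k. g (int k)) {..n} / real n"
    by (simp add: ip_def divide_right_mono)
  also have "\<dots> = sqrt (ip n f f) * sqrt (ip n g g)"
    by (simp add: ip_def L2_set_def real_sqrt_divide power2_eq_square)
  finally show ?thesis .
qed

lemma sum_shift_causal:
  assumes "causal h"
  shows "(\<Sum>k\<le>n. h (int k - 1)) = (\<Sum>k\<le>n. h (int k)) - h (int n)"
  using assms by (induction n) (auto simp: causal_def)

lemma ip_lag_1: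
  assumes "causal f" "causal g"
  shows "ip n (lag 1 f) (lag 1 g) = ip n f g - f (int n) * g (int n) / real n"
  using sum_shift_causal[of "\<lambda>k. f k * g k" n] assms
  by (simp add: ip_def lag_def causal_def diff_divide_distrib)

text \<open>
Lagging a causal sequence only removes terms from its sum of squares.
\<close>
lemma ip_lag_le:
  assumes "causal f"
  shows "ip n (lag j f) (lag j f) \<le> ip n f f"
proof (induction j)
  case (Suc j)
  have "ip n (lag (Suc j) f) (lag (Suc j) f) \<le> ip n (lag j f) (lag j f)"
    using ip_lag_1[of "lag j f" "lag j f" n] assms by (simp add: causal_lag lag_lag)
  with Suc show ?case by simp
qed simp

lemma slow_lag:
  assumes "slow f" "causal f"
  shows "slow (lag j f)"
  unfolding slow_def
proof (intro allI impI)
  fix \<delta> :: real assume "\<delta> > 0"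
  then obtain B where B: "\<bar>f (int n)\<bar> \<le> B + \<delta> * sqrt (real n)" for n
    using assms(1) unfolding slow_def by blast
  have "\<bar>lag j f (int n)\<bar> \<le> B + \<delta> * sqrt (real n)" for n
  proof (cases "j \<le> n")
    case True
    then have "\<bar>lag j f (int n)\<bar> \<le> B + \<delta> * sqrt (real (n - j))"
      using B[of "n - j"] by (simp add: lag_def of_nat_diff)
    also have "\<dots> \<le> B + \<delta> * sqrt (real n)"
      using \<open>\<delta> > 0\<close> by simp
    finally show ?thesis .
  next
    case False
    then show ?thesis
      using assms(2) B[of n] by (simp add: lag_def causal_def)
  qed
  then show "\<exists>B. \<forall>n. \<bar>lag j f (int n)\<bar> \<le> B + \<delta> * sqrt (real n)" by blast
qed

lemma slow_iff: "slow f \<longleftrightarrow> (\<lambda>n. f (int n) / sqrt (real n)) \<longlonglongrightarrow> 0"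
proof
  assume f: "slow f"
  show "(\<lambda>n. f (int n) / sqrt (real n)) \<longlonglongrightarrow> 0"
  proof (rule LIMSEQ_I)
    fix r :: real assume "r > 0"
    then obtain B where B: "\<bar>f (int n)\<bar> \<le> B + r / 2 * sqrt (real n)" for n
      using f unfolding slow_def by (meson half_gt_zero)
    have "(\<lambda>n. B / sqrt (real n)) \<longlonglongrightarrow> 0" by real_asymp
    then have "eventually (\<lambda>n. B / sqrt (real n) < r / 2) sequentially"
      using \<open>r > 0\<close> by (intro order_tendstoD) auto
    then have "eventually (\<lambda>n. norm (f (int n) / sqrt (real n) - 0) < r) sequentially"
      using eventually_gt_at_top[of 0]
    proof eventually_elim
      case (elim n)
      have "\<bar>f (int n)\<bar> / sqrt (real n) \<le> (B + r / 2 * sqrt (real n)) / sqrt (real n)"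
        by (intro divide_right_mono B) simp
      also have "\<dots> = B / sqrt (real n) + r / 2"
        using elim(2) by (simp add: add_divide_distrib)
      finally have "\<bar>f (int n)\<bar> / sqrt (real n) < r" using elim(1) by linarith
      then show ?case by (simp add: abs_divide)
    qed
    then show "\<exists>no. \<forall>n\<ge>no. norm (f (int n) / sqrt (real n) - 0) < r"
      by (simp add: eventually_sequentially)
  qed
next
  assume lim: "(\<lambda>n. f (int n) / sqrt (real n)) \<longlonglongrightarrow> 0"
  show "slow f"
    unfolding slow_def
  proof (intro allI impI)
    fix \<delta> :: real assume "\<delta> > 0"
    from LIMSEQ_D[OF lim this] obtain N where
      N: "\<bar>f (int n)\<bar> / sqrt (real n) < \<delta>" if "n \<ge> N" for n
      by (auto simp: abs_divide)
    have "\<bar>f (int n)\<bar> \<le> (\<Sum>k\<le>N. \<bar>f (int k)\<bar>) + \<delta> * sqrt (real n)" for n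
    proof (cases "n \<le> N")
      case True
      then have "\<bar>f (int n)\<bar> \<le> (\<Sum>k\<le>N. \<bar>f (int k)\<bar>)"
        by (intro member_le_sum) auto
      also have "\<dots> \<le> (\<Sum>k\<le>N. \<bar>f (int k)\<bar>) + \<delta> * sqrt (real n)"
        using \<open>\<delta> > 0\<close> by simp
      finally show ?thesis .
    next
      case False
      then have "\<bar>f (int n)\<bar> \<le> \<delta> * sqrt (real n)"
        using N[of n] by (simp add: divide_simps)
      moreover have "0 \<le> (\<Sum>k\<le>N. \<bar>f (int k)\<bar>)" by (intro sum_nonneg) auto
      ultimately show ?thesis by linarith
    qed
    then show "\<exists>B. \<forall>n. \<bar>f (int n)\<bar> \<le> B + \<delta> * sqrt (real n)" by blast
  qed
qed

lemma slow_diff: "slow f \<Longrightarrow> slow g \<Longrightarrow> slow (\<lambda>k. f k - g k)"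
  unfolding slow_iff diff_divide_distrib using tendsto_diff[of _ 0 sequentially _ 0] by simp

lemma slow_combination: "(\<And>i. i \<in> I \<Longrightarrow> slow (f i)) \<Longrightarrow> slow (\<lambda>k. \<Sum>i\<in>I. a i * f i k)"
  unfolding slow_iff sum_divide_distrib times_divide_eq_right[symmetric]
  by (intro tendsto_null_sum tendsto_mult_right_zero)

text \<open>
A simultaneous shift by one drops the single product \<open>f n * g n\<close>, which is \<open>o(n)\<close>.
\<close>
lemma ip_lag_asymp:
  assumes "slow f" "causal f" "slow g" "causal g"
  shows "(\<lambda>n. ip n (lag j f) (lag j g)) \<doteq> (\<lambda>n. ip n f g)"
proof (induction j)
  case (Suc j)
  have "(\<lambda>n. ip n (lag (Suc j) f) (lag (Suc j) g)) \<doteq> (\<lambda>n. ip n (lag j f) (lag j g))"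
  proof -
    have "(\<lambda>n. - (lag j f (int n) / sqrt (real n) * (lag j g (int n) / sqrt (real n)))) \<longlonglongrightarrow> - (0 * 0)"
      using assms by (intro tendsto_minus tendsto_mult) (simp_all add: slow_lag flip: slow_iff)
    then show ?thesis
      using ip_lag_1[of "lag j f" "lag j g"] assms
      by (simp add: asymp_eq_def lag_lag causal_lag)
  qed
  then show ?case using Suc by (rule asymp_eq_trans)
qed simp

lemma bounded_powerE:
  assumes "bounded_power f"
  obtains C where "0 \<le> C" "\<And>n. ip n f f \<le> C"
  using assms ip_nonneg[of 0 f] unfolding bounded_power_def by (meson order_trans)

lemma ip_bounded:
  assumes "bounded_power f" "bounded_power g" "causal g"
  obtains C where "0 \<le> C" "\<And>n j. \<bar>ip n f (lag j g)\<bar> \<le> C"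
proof -
  obtain C D where C: "0 \<le> C" "\<And>n. ip n f f \<le> C" and D: "0 \<le> D" "\<And>n. ip n g g \<le> D"
    using assms by (metis bounded_powerE)
  have "\<bar>ip n f (lag j g)\<bar> \<le> sqrt C * sqrt D" for n j
  proof -
    have "\<bar>ip n f (lag j g)\<bar> \<le> sqrt (ip n f f) * sqrt (ip n (lag j g) (lag j g))"
      by (rule ip_Cauchy_Schwarz)
    also have "\<dots> \<le> sqrt C * sqrt D"
      using C D(1) order_trans[OF ip_lag_le[OF assms(3)] D(2)]
      by (intro mult_mono) (auto simp: ip_nonneg)
    finally show ?thesis .
  qed
  with C(1) D(1) show ?thesis by (intro that[of "sqrt C * sqrt D"]) auto
qed

lemma bounded_power_lag [intro]: "bounded_power f \<Longrightarrow> causal f \<Longrightarrow> bounded_power (lag j f)"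
  unfolding bounded_power_def by (meson ip_lag_le order_trans)

lemma bounded_power_cmult: "bounded_power f \<Longrightarrow> bounded_power (\<lambda>k. c * f k)"
proof (erule bounded_powerE)
  fix C assume "0 \<le> C" and C: "\<And>n. ip n f f \<le> C"
  have "ip n (\<lambda>k. c * f k) (\<lambda>k. c * f k) \<le> c * c * C" for n
    using C[of n] by (simp add: ip_cmult_left ip_cmult_right mult.assoc[symmetric] mult_left_mono)
  then show ?thesis unfolding bounded_power_def by blast
qed

lemma bounded_power_add: "bounded_power f \<Longrightarrow> bounded_power g \<Longrightarrow> bounded_power (\<lambda>k. f k + g k)"
proof (elim bounded_powerE)
  fix C D assume C: "\<And>n. ip n f f \<le> C" and D: "\<And>n. ip n g g \<le> D"
  have "ip n (\<lambda>k. f k + g k) (\<lambda>k. f k + g k) \<le> 2 * C + 2 * D" for n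
  proof -
    have "0 \<le> ip n (\<lambda>k. f k - g k) (\<lambda>k. f k - g k)" by (rule ip_nonneg)
    then show ?thesis
      using C[of n] D[of n] ip_commute[of n f g]
      by (simp add: ip_diff_left ip_diff_right ip_add_left ip_add_right)
  qed
  then show ?thesis unfolding bounded_power_def by blast
qed

lemma bounded_power_combination:
  assumes "\<And>i. i \<in> I \<Longrightarrow> bounded_power (f i)"
  shows "bounded_power (\<lambda>k. \<Sum>i\<in>I. a i * f i k)"
  using assms
proof (induction I rule: infinite_finite_induct)
  case (insert i I)
  then show ?case by (simp add: bounded_power_add bounded_power_cmult)
qed (auto simp: bounded_power_def ip_def)

lemma bounded_power_diff_combination:
  assumes "bounded_power f" "\<And>i. i \<in> I \<Longrightarrow> bounded_power (g i)"
  shows "bounded_power (\<lambda>k. f k - (\<Sum>i\<in>I. a i * g i k))"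
  using bounded_power_add[OF assms(1) bounded_power_combination[of I g "\<lambda>i. - a i", OF assms(2)]]
  by (simp add: sum_negf)

text \<open>
A sequence that may vary with \<open>n\<close> can be discarded from inner products as soon as its power vanishes.
\<close>
lemma ip_negligible:
  assumes "bounded_power f" "(\<lambda>n. ip n (U n) (U n)) \<longlonglongrightarrow> 0"
  shows "(\<lambda>n. ip n f (U n)) \<longlonglongrightarrow> 0"
proof -
  obtain C where C: "0 \<le> C" "\<And>n. ip n f f \<le> C" using bounded_powerE[OF assms(1)] by blast
  show ?thesis
  proof (rule Lim_null_comparison)
    have "\<bar>ip n f (U n)\<bar> \<le> sqrt C * sqrt (ip n (U n) (U n))" for n
      by (rule order_trans[OF ip_Cauchy_Schwarz]) (simp add: C mult_right_mono ip_nonneg)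
    then show "eventually (\<lambda>n. norm (ip n f (U n)) \<le> sqrt C * sqrt (ip n (U n) (U n))) sequentially"
      by simp
    show "(\<lambda>n. sqrt C * sqrt (ip n (U n) (U n))) \<longlonglongrightarrow> 0"
      using tendsto_mult_left[OF tendsto_real_sqrt[OF assms(2)], of "sqrt C"] by simp
  qed
qed

lemma ip_perturb:
  assumes f: "bounded_power f" and g: "bounded_power g"
    and U: "(\<lambda>n. ip n (U n) (U n)) \<longlonglongrightarrow> 0" and W: "(\<lambda>n. ip n (W n) (W n)) \<longlonglongrightarrow> 0"
  shows "(\<lambda>n. ip n (\<lambda>k. f k - U n k) (\<lambda>k. g k - W n k)) \<doteq> (\<lambda>n. ip n f g)"
proof -
  have "(\<lambda>n. sqrt (ip n (U n) (U n)) * sqrt (ip n (W n) (W n))) \<longlonglongrightarrow> sqrt 0 * sqrt 0"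
    by (intro tendsto_mult tendsto_real_sqrt U W)
  then have UW: "(\<lambda>n. sqrt (ip n (U n) (U n)) * sqrt (ip n (W n) (W n))) \<longlonglongrightarrow> 0" by simp
  have "(\<lambda>n. ip n (U n) (W n)) \<longlonglongrightarrow> 0"
    by (rule Lim_null_comparison[OF _ UW]) (simp add: ip_Cauchy_Schwarz)
  then have "(\<lambda>n. ip n (U n) (W n) - ip n f (W n) - ip n g (U n)) \<longlonglongrightarrow> 0 - 0 - 0"
    by (intro tendsto_diff ip_negligible f g U W)
  moreover have "ip n (\<lambda>k. f k - U n k) (\<lambda>k. g k - W n k) - ip n f g =
      ip n (U n) (W n) - ip n f (W n) - ip n g (U n)" for n
    unfolding ip_diff_left ip_diff_right ip_commute[of n g "U n"] by simp
  ultimately show ?thesis by (simp add: asymp_eq_def)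
qed

section \<open>Stable autoregressive filters\<close>

text \<open>
The output \<open>f\<close> of an autoregressive recursion driven by \<open>g\<close>. The bound on the coefficients makes the
recursion a contraction, and each property below is transferred from \<open>g\<close> to \<open>f\<close> by that contraction.
\<close>
locale stable_filter =
  fixes q :: nat and a :: "nat \<Rightarrow> real" and f g :: "int \<Rightarrow> real"
  assumes a: "(\<Sum>i=1..q. \<bar>a i\<bar>) < 1"
    and causal_f: "causal f"
    and f_eq: "\<And>k. f k = (\<Sum>i=1..q. a i * lag i f k) + g k"
begin

lemma f_eq': "f = (\<lambda>k. (\<Sum>i=1..q. a i * lag i f k) + g k)"
  using f_eq by (rule ext)

lemma ip_filter: "ip n h f = (\<Sum>i=1..q. a i * ip n h (lag i f)) + ip n h g"
  by (subst f_eq') (simp only: ip_add_right ip_sum_right)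

lemma lag_filter: "lag j f = (\<lambda>k. (\<Sum>i=1..q. a i * lag (j + i) f k) + lag j g k)"
proof
  fix k show "lag j f k = (\<Sum>i=1..q. a i * lag (j + i) f k) + lag j g k"
    using f_eq[of "k - int j"] by (simp add: lag_def algebra_simps)
qed

text \<open>
With \<open>P\<^sup>2\<close> the power of \<open>f\<close>, the recursion and the Cauchy-Schwarz inequality give
\<open>P\<^sup>2 \<le> A * P\<^sup>2 + P * sqrt C\<close> with \<open>A < 1\<close>.
\<close>
lemma bounded_power_filter:
  assumes "bounded_power g"
  shows "bounded_power f"
proof -
  define A where "A = (\<Sum>i=1..q. \<bar>a i\<bar>)"
  obtain C where C: "0 \<le> C" "\<And>n. ip n g g \<le> C" using bounded_powerE[OF assms] by blast
  have "ip n f f \<le> C / (1 - A)\<^sup>2" for n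
  proof -
    define P where "P = sqrt (ip n f f)"
    have P: "ip n f f = P * P" "0 \<le> P" unfolding P_def by (simp_all add: ip_nonneg)
    have "\<bar>a i * ip n f (lag i f)\<bar> \<le> \<bar>a i\<bar> * (P * P)" for i
    proof -
      have "\<bar>ip n f (lag i f)\<bar> \<le> sqrt (ip n f f) * sqrt (ip n (lag i f) (lag i f))"
        by (rule ip_Cauchy_Schwarz)
      also have "\<dots> \<le> P * P"
        unfolding P_def by (intro mult_left_mono real_sqrt_le_mono ip_lag_le causal_f) (simp add: ip_nonneg)
      finally show ?thesis by (simp add: abs_mult mult_left_mono)
    qed
    then have "(\<Sum>i=1..q. a i * ip n f (lag i f)) \<le> (\<Sum>i=1..q. \<bar>a i\<bar> * (P * P))"
      by (intro sum_mono) (metis abs_le_D1)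
    also have "\<dots> = A * (P * P)" by (simp add: A_def sum_distrib_right)
    finally have "P * P \<le> A * (P * P) + ip n f g"
      using ip_filter[of n f] P(1) by simp
    also have "ip n f g \<le> P * sqrt C"
      using ip_Cauchy_Schwarz[of n f g] C(2)[of n]
        mult_left_mono[OF real_sqrt_le_mono[OF C(2)[of n]] P(2)] unfolding P_def by linarith
    finally have "P * ((1 - A) * P) \<le> P * sqrt C" by (simp add: algebra_simps)
    then have "(1 - A) * P \<le> sqrt C"
      using P(2) C(1) by (cases "P = 0") auto
    moreover have "0 \<le> (1 - A) * P" using a P(2) by (simp add: A_def)
    ultimately have "((1 - A) * P)\<^sup>2 \<le> (sqrt C)\<^sup>2" by (rule power_mono)
    then have "(1 - A)\<^sup>2 * ip n f f \<le> C"
      using C(1) P(1) by (simp add: power2_eq_square mult_ac)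
    then show ?thesis
      using a by (simp add: A_def field_simps)
  qed
  then show ?thesis unfolding bounded_power_def by blast
qed

lemma slow_filter:
  assumes "slow g"
  shows "slow f"
  unfolding slow_def
proof (intro allI impI)
  fix \<delta> :: real assume "\<delta> > 0"
  define A where "A = (\<Sum>i=1..q. \<bar>a i\<bar>)"
  have A: "0 \<le> A" "A < 1" using a by (simp_all add: A_def sum_nonneg)
  obtain B where B: "\<bar>g (int n)\<bar> \<le> B + \<delta> * (1 - A) * sqrt (real n)" for n
    using assms \<open>\<delta> > 0\<close> A unfolding slow_def by (metis mult_pos_pos diff_gt_0_iff_gt)
  have "B \<ge> 0" using B[of 0] by simp
  have "\<bar>f (int n)\<bar> \<le> B / (1 - A) + \<delta> * sqrt (real n)" (is "_ \<le> ?R n") for n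
  proof (induction n rule: less_induct)
    case (less n)
    have R0: "0 \<le> ?R n" using A \<open>B \<ge> 0\<close> \<open>\<delta> > 0\<close> by simp
    have "\<bar>lag i f (int n)\<bar> \<le> ?R n" if "1 \<le> i" for i
    proof (cases "i \<le> n")
      case True
      then have "\<bar>lag i f (int n)\<bar> \<le> ?R (n - i)"
        using less[of "n - i"] that by (simp add: lag_def of_nat_diff)
      also have "\<dots> \<le> ?R n" using \<open>\<delta> > 0\<close> by simp
      finally show ?thesis .
    next
      case False
      then show ?thesis using causal_f R0 by (simp add: causal_def lag_def)
    qed
    then have "\<bar>\<Sum>i=1..q. a i * lag i f (int n)\<bar> \<le> (\<Sum>i=1..q. \<bar>a i\<bar> * ?R n)"
      by (intro order_trans[OF sum_abs] sum_mono) (auto simp: abs_mult intro!: mult_left_mono)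
    also have "\<dots> = A * ?R n" by (simp add: A_def sum_distrib_right)
    finally have "\<bar>f (int n)\<bar> \<le> A * ?R n + (B + \<delta> * (1 - A) * sqrt (real n))"
      using B[of n] by (subst f_eq) linarith
    also have "\<dots> = ?R n" using A(2) by (simp add: field_simps)
    finally show ?case .
  qed
  then show "\<exists>B. \<forall>n. \<bar>f (int n)\<bar> \<le> B + \<delta> * sqrt (real n)" by blast
qed

text \<open>
If all correlations of \<open>v\<close> with lags of \<open>f\<close> are asymptotically at most \<open>K\<close>, then the recursion
improves the bound to \<open>A * K\<close>, since the lags of \<open>g\<close> contribute nothing in the limit. Starting from
the bound given by the Cauchy-Schwarz inequality and iterating, the correlations vanish.
\<close>
lemma decorrelated_filter:
  assumes v: "bounded_power v" and g: "bounded_power g"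
    and g_lim: "\<And>j. j \<ge> 1 \<Longrightarrow> (\<lambda>n. ip n v (lag j g)) \<longlonglongrightarrow> 0"
    and "j \<ge> 1"
  shows "(\<lambda>n. ip n v (lag j f)) \<longlonglongrightarrow> 0"
proof -
  define A where "A = (\<Sum>i=1..q. \<bar>a i\<bar>)"
  have A: "0 \<le> A" "A < 1" using a by (simp_all add: A_def sum_nonneg)
  obtain C where C: "0 \<le> C" "\<And>n j. \<bar>ip n v (lag j f)\<bar> \<le> C"
    using ip_bounded[OF v bounded_power_filter[OF g] causal_f] by blast
  have step: "eventually (\<lambda>n. \<bar>ip n v (lag j f)\<bar> \<le> A ^ m * C + \<delta>) sequentially"
    if "\<delta> > 0" "j \<ge> 1" for m j \<delta>
    using that(2)
  proof (induction m arbitrary: j)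
    case 0
    have "\<bar>ip n v (lag j f)\<bar> \<le> A ^ 0 * C + \<delta>" for n
      using C(2)[of n j] \<open>\<delta> > 0\<close> by simp
    then show ?case by simp
  next
    case (Suc m)
    have "eventually (\<lambda>n. \<forall>i\<in>{1..q}. \<bar>ip n v (lag (j + i) f)\<bar> \<le> A ^ m * C + \<delta>) sequentially"
      using Suc by (intro eventually_ball_finite) auto
    moreover have "eventually (\<lambda>n. \<bar>ip n v (lag j g)\<bar> < (1 - A) * \<delta>) sequentially"
      using tendsto_rabs[OF g_lim[OF Suc.prems]] A \<open>\<delta> > 0\<close> by (intro order_tendstoD) auto
    ultimately show ?case
    proof eventually_elim
      case (elim n)
      have "\<bar>\<Sum>i=1..q. a i * ip n v (lag (j + i) f)\<bar> \<le> (\<Sum>i=1..q. \<bar>a i\<bar> * (A ^ m * C + \<delta>))"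
        using elim(1) by (intro order_trans[OF sum_abs] sum_mono) (auto simp: abs_mult intro!: mult_left_mono)
      also have "\<dots> = A * (A ^ m * C + \<delta>)" by (simp add: A_def sum_distrib_right)
      finally have "\<bar>ip n v (lag j f)\<bar> \<le> A * (A ^ m * C + \<delta>) + (1 - A) * \<delta>"
        using elim(2) unfolding lag_filter[of j] ip_add_right ip_sum_right by linarith
      then show ?case by (simp add: algebra_simps)
    qed
  qed
  show ?thesis
  proof (rule LIMSEQ_I)
    fix r :: real assume "r > 0"
    have "(\<lambda>m. A ^ m * C) \<longlonglongrightarrow> 0 * C"
      using A by (intro tendsto_mult_right LIMSEQ_power_zero) auto
    then have "eventually (\<lambda>m. A ^ m * C < r / 2) sequentially"
      using \<open>r > 0\<close> by (intro order_tendstoD) auto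
    then obtain m where m: "A ^ m * C < r / 2" by (meson eventually_happens sequentially_bot)
    have "eventually (\<lambda>n. \<bar>ip n v (lag j f)\<bar> \<le> A ^ m * C + r / 2) sequentially"
      using step \<open>r > 0\<close> \<open>j \<ge> 1\<close> by simp
    then have "eventually (\<lambda>n. norm (ip n v (lag j f) - 0) < r) sequentially"
      by eventually_elim (use m in simp)
    then show "\<exists>no. \<forall>n\<ge>no. norm (ip n v (lag j f) - 0) < r"
      by (simp add: eventually_sequentially)
  qed
qed

end

section \<open>Levinson symmetry of an autoregressive path\<close>

text \<open>
One sample path of the model, extended by \<open>0\<close> to negative times. At time \<open>0\<close> the recursions force
\<open>v 0 = e 0 = x 0\<close>, so the initial value is treated as the first innovation.
\<close>
locale autoregressive_path =
  fixes p :: nat and \<theta> :: "nat \<Rightarrow> real" and \<rho> s :: real and x e v :: "int \<Rightarrow> real"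
  assumes p: "p \<ge> 1"
    and stable: "(\<Sum>i=1..p. \<bar>\<theta> i\<bar>) < 1" "\<bar>\<rho>\<bar> < 1"
    and causal: "causal x" "causal e" "causal v"
    and x_eq: "\<And>k. x k = (\<Sum>i=1..p. \<theta> i * lag i x k) + e k"
    and e_eq: "\<And>k. e k = \<rho> * lag 1 e k + v k"
    and s: "0 < s"
    and v_power: "(\<lambda>n. ip n v v) \<longlonglongrightarrow> s"
    and v_white: "\<And>j. j \<ge> 1 \<Longrightarrow> (\<lambda>n. ip n v (lag j v)) \<longlonglongrightarrow> 0"
begin

sublocale x_filter: stable_filter p \<theta> x e
  by unfold_locales (use stable causal x_eq in auto)

sublocale e_filter: stable_filter 1 "\<lambda>_. \<rho>" e v
  by unfold_locales (use stable causal e_eq in auto)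

lemma bounded_power_v: "bounded_power v"
proof -
  have "Bseq (\<lambda>n. ip n v v)" by (rule convergent_imp_Bseq[OF convergentI[OF v_power]])
  then obtain K where "\<forall>n. norm (ip n v v) \<le> K" unfolding Bseq_def by blast
  then have "\<forall>n. ip n v v \<le> K" by (auto intro: abs_le_D1)
  then show ?thesis unfolding bounded_power_def by blast
qed

text \<open>
The quotient \<open>(v n)\<^sup>2 / n\<close> is the difference of two consecutive averages with the same limit.
\<close>
lemma slow_v: "slow v"
proof -
  have "(\<lambda>n. ip (Suc n) v v - ip n v v * (real n / real (Suc n))) \<longlonglongrightarrow> s - s * 1"
    by (intro tendsto_diff tendsto_mult LIMSEQ_Suc[OF v_power] v_power LIMSEQ_n_over_Suc_n)
  moreover have "eventually (\<lambda>n. ip (Suc n) v v - ip n v v * (real n / real (Suc n)) =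
      (v (int (Suc n)))\<^sup>2 / real (Suc n)) sequentially"
    using eventually_gt_at_top[of 0]
    by eventually_elim (simp add: ip_def power2_eq_square add_divide_distrib del: of_nat_Suc)
  ultimately have "(\<lambda>n. (v (int (Suc n)))\<^sup>2 / real (Suc n)) \<longlonglongrightarrow> 0"
    by (simp add: tendsto_cong)
  then have "(\<lambda>n. sqrt ((v (int n))\<^sup>2 / real n)) \<longlonglongrightarrow> sqrt 0"
    by (intro tendsto_real_sqrt) (rule LIMSEQ_imp_Suc)
  then have "(\<lambda>n. \<bar>v (int n) / sqrt (real n)\<bar>) \<longlonglongrightarrow> 0"
    by (simp add: real_sqrt_divide abs_divide)
  then show ?thesis unfolding slow_iff by (rule tendsto_rabs_zero_cancel)
qed

lemma bounded_power_x: "bounded_power x"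
  by (intro x_filter.bounded_power_filter e_filter.bounded_power_filter bounded_power_v)

lemma slow_x: "slow x"
  by (intro x_filter.slow_filter e_filter.slow_filter slow_v)

lemma v_orthogonal_past:
  assumes "j \<ge> 1"
  shows "(\<lambda>n. ip n v (lag j x)) \<longlonglongrightarrow> 0"
  by (intro x_filter.decorrelated_filter e_filter.decorrelated_filter e_filter.bounded_power_filter
      bounded_power_v v_white assms)

lemma v_x_limit: "(\<lambda>n. ip n v x) \<longlonglongrightarrow> s"
proof -
  have "(\<lambda>n. ip n v (lag 1 e)) \<longlonglongrightarrow> 0"
    by (intro e_filter.decorrelated_filter bounded_power_v v_white) auto
  then have "(\<lambda>n. \<rho> * ip n v (lag 1 e) + ip n v v) \<longlonglongrightarrow> \<rho> * 0 + s"
    by (intro tendsto_intros v_power)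
  then have "(\<lambda>n. ip n v e) \<longlonglongrightarrow> s"
    using e_filter.ip_filter[of _ v] by simp
  moreover have "(\<lambda>n. \<Sum>i=1..p. \<theta> i * ip n v (lag i x)) \<longlonglongrightarrow> 0"
    by (intro tendsto_null_sum tendsto_mult_right_zero v_orthogonal_past) auto
  ultimately show ?thesis
    using x_filter.ip_filter[of _ v] tendsto_add[of _ 0 sequentially _ s] by simp
qed

definition \<kappa> :: real where "\<kappa> = \<theta> p * \<rho>"

text \<open>
The process satisfies an autoregression of order \<open>p + 1\<close>: its first \<open>p\<close> coefficients are the \<open>\<beta> i\<close>,
and the last one is \<open>- \<kappa>\<close>.
\<close>
definition \<beta> :: "nat \<Rightarrow> real" where
  "\<beta> i = (if i = 1 then \<theta> 1 + \<rho> else \<theta> i - \<theta> (i - 1) * \<rho>)"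

definition \<theta>_star :: "nat \<Rightarrow> real" where
  "\<theta>_star i = (\<beta> i - \<kappa> * \<beta> (p + 1 - i)) / ((1 - \<kappa>) * (1 + \<kappa>))"

definition fwd :: "int \<Rightarrow> real" where
  "fwd k = x k - (\<Sum>i=1..p. \<theta>_star i * lag i x k)"

text \<open>
The time reversal of \<open>fwd\<close>: the value at the oldest time \<open>k - p - 1\<close> is predicted from the \<open>p\<close> values
that follow it.
\<close>
definition bwd :: "int \<Rightarrow> real" where
  "bwd k = lag (p + 1) x k - (\<Sum>i=1..p. \<theta>_star i * lag (p + 1 - i) x k)"

lemma abs_\<kappa>_less_1: "\<bar>\<kappa>\<bar> < 1"
proof -
  have "\<bar>\<theta> p\<bar> \<le> (\<Sum>i=1..p. \<bar>\<theta> i\<bar>)"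
    using p by (intro member_le_sum) auto
  then have "\<bar>\<theta> p\<bar> * \<bar>\<rho>\<bar> < 1 * 1"
    using stable by (intro mult_strict_mono') auto
  then show ?thesis by (simp add: \<kappa>_def abs_mult)
qed

text \<open>
The matrix \<open>\<alpha> (I - \<kappa> J)\<close> is the inverse of \<open>I + \<kappa> J\<close>, because \<open>J\<^sup>2 = I\<close>. So \<open>\<theta>*\<close> solves
\<open>\<beta> = (I + \<kappa> J) \<theta>*\<close>.
\<close>
lemma \<beta>_reconstruction:
  assumes "1 \<le> i" "i \<le> p"
  shows "\<beta> i = \<theta>_star i + \<kappa> * \<theta>_star (p + 1 - i)"
proof -
  have "(1 - \<kappa>) * (1 + \<kappa>) \<noteq> 0" using abs_\<kappa>_less_1 by auto
  moreover have "p + 1 - (p + 1 - i) = i" using assms by simp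
  ultimately show ?thesis
    unfolding \<theta>_star_def by (simp add: add_divide_distrib[symmetric] eq_divide_eq) (simp add: algebra_simps)
qed

text \<open>
Applying \<open>1 - \<rho> B\<close>, with \<open>B\<close> the backward shift, to the equation for \<open>x\<close> eliminates \<open>e\<close>.
\<close>
lemma v_eq_AR: "v k = x k - (\<Sum>i=1..p. \<beta> i * lag i x k) + \<kappa> * lag (p + 1) x k"
proof -
  have "v k = e k - \<rho> * e (k - 1)"
    using e_eq[of k] by (simp add: lag_def)
  also have "e (k - 1) = x (k - 1) - (\<Sum>i=1..p. \<theta> i * lag (i + 1) x k)"
    using x_eq[of "k - 1"] by (simp add: lag_def algebra_simps)
  also have "(\<Sum>i=1..p. \<theta> i * lag (i + 1) x k) = (\<Sum>i=1..<p. \<theta> i * lag (i + 1) x k) + \<theta> p * lag (p + 1) x k"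
    using p by (simp add: sum.last_plus atLeastLessThanSuc_atLeastAtMost[symmetric])
  finally have v: "v k = x k - (\<Sum>i=1..p. \<theta> i * lag i x k) - \<rho> * x (k - 1)
      + \<rho> * (\<Sum>i=1..<p. \<theta> i * lag (i + 1) x k) + \<kappa> * lag (p + 1) x k"
    using x_eq[of k] by (simp add: \<kappa>_def algebra_simps)
  have "(\<Sum>i=1..p. \<beta> i * lag i x k) = \<beta> 1 * lag 1 x k + (\<Sum>i=2..p. \<beta> i * lag i x k)"
    using p by (simp add: sum.atLeast_Suc_atMost numeral_2_eq_2)
  also have "(\<Sum>i=2..p. \<beta> i * lag i x k) = (\<Sum>i=2..p. \<theta> i * lag i x k) - \<rho> * (\<Sum>i=2..p. \<theta> (i - 1) * lag i x k)"
    by (simp add: \<beta>_def sum_distrib_left sum_subtractf[symmetric] algebra_simps)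
  also have "(\<Sum>i=2..p. \<theta> (i - 1) * lag i x k) = (\<Sum>i=1..<p. \<theta> i * lag (i + 1) x k)"
    by (rule sum.reindex_bij_witness[of _ "\<lambda>i. i + 1" "\<lambda>i. i - 1"]) auto
  finally have "(\<Sum>i=1..p. \<beta> i * lag i x k) = \<beta> 1 * lag 1 x k + (\<Sum>i=2..p. \<theta> i * lag i x k)
      - \<rho> * (\<Sum>i=1..<p. \<theta> i * lag (i + 1) x k)" by simp
  moreover have "(\<Sum>i=1..p. \<theta> i * lag i x k) = \<theta> 1 * lag 1 x k + (\<Sum>i=2..p. \<theta> i * lag i x k)"
    using p by (simp add: sum.atLeast_Suc_atMost numeral_2_eq_2)
  ultimately show ?thesis
    using v by (simp add: \<beta>_def lag_def algebra_simps)
qed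

text \<open>
The Levinson step: \<open>\<kappa>\<close> is, up to sign, the partial autocorrelation at lag \<open>p + 1\<close>.
\<close>
lemma innovation_decomposition: "v = (\<lambda>k. fwd k + \<kappa> * bwd k)"
proof
  fix k
  have "(\<Sum>i=1..p. \<beta> i * lag i x k) = (\<Sum>i=1..p. \<theta>_star i * lag i x k) + \<kappa> * (\<Sum>i=1..p. \<theta>_star (p + 1 - i) * lag i x k)"
    by (simp add: \<beta>_reconstruction sum_distrib_left sum.distrib[symmetric] algebra_simps)
  also have "(\<Sum>i=1..p. \<theta>_star (p + 1 - i) * lag i x k) = (\<Sum>i=1..p. \<theta>_star i * lag (p + 1 - i) x k)"
    by (rule sum.reindex_bij_witness[of _ "\<lambda>i. p + 1 - i" "\<lambda>i. p + 1 - i"]) auto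
  finally show "v k = fwd k + \<kappa> * bwd k"
    by (simp add: v_eq_AR fwd_def bwd_def algebra_simps)
qed

lemma causal_fwd: "causal fwd"
  using causal(1) by (simp add: causal_def fwd_def lag_def)

lemma bounded_power_fwd: "bounded_power fwd" and bounded_power_bwd: "bounded_power bwd"
  unfolding fwd_def[abs_def] bwd_def[abs_def]
  by (intro bounded_power_diff_combination bounded_power_x bounded_power_lag causal)+

lemma ip_fwd_left: "ip n fwd g = ip n x g - (\<Sum>i=1..p. \<theta>_star i * ip n (lag i x) g)"
  unfolding fwd_def[abs_def] ip_diff_left ip_sum_left ..

lemma ip_bwd_left:
  "ip n bwd g = ip n (lag (p + 1) x) g - (\<Sum>i=1..p. \<theta>_star i * ip n (lag (p + 1 - i) x) g)"
  unfolding bwd_def[abs_def] ip_diff_left ip_sum_left ..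

lemma autocovariance_Toeplitz:
  assumes "int i' - int j' = int i - int j"
  shows "(\<lambda>n. ip n (lag i x) (lag j x)) \<doteq> (\<lambda>n. ip n (lag i' x) (lag j' x))"
proof -
  have shift: "(\<lambda>n. ip n (lag (m + i) x) (lag (m + j) x)) \<doteq> (\<lambda>n. ip n (lag i x) (lag j x))" for m i j
    using ip_lag_asymp[of "lag i x" "lag j x" m] slow_x causal(1)
    by (simp add: slow_lag causal_lag lag_lag)
  show ?thesis
  proof (cases "i \<le> i'")
    case True
    then have "i' = (i' - i) + i" "j' = (i' - i) + j" using assms by auto
    then show ?thesis using shift[of "i' - i" i j] by (metis asymp_eq_sym)
  next
    case False
    then have "i = (i - i') + i'" "j = (i - i') + j'" using assms by auto
    then show ?thesis using shift[of "i - i'" i' j'] by metis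
  qed
qed

text \<open>
Under the Toeplitz property an inner product depends only on the difference of the two lags,
which is preserved by reversing the window of times \<open>k - p - 1, \<dots>, k\<close> and swapping the arguments.
\<close>
lemma time_reversal:
  assumes "j \<le> p + 1"
  shows "(\<lambda>n. ip n bwd (lag j x)) \<doteq> (\<lambda>n. ip n fwd (lag (p + 1 - j) x))"
proof -
  have swap: "(\<lambda>n. ip n (lag (p + 1 - i) x) (lag j x)) \<doteq> (\<lambda>n. ip n (lag i x) (lag (p + 1 - j) x))"
    if "i \<le> p + 1" for i
    unfolding ip_commute[of _ "lag i x"] using that assms by (intro autocovariance_Toeplitz) auto
  have "(\<lambda>n. ip n (lag (p + 1) x) (lag j x) - (\<Sum>i=1..p. \<theta>_star i * ip n (lag (p + 1 - i) x) (lag j x)))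
     \<doteq> (\<lambda>n. ip n x (lag (p + 1 - j) x) - (\<Sum>i=1..p. \<theta>_star i * ip n (lag i x) (lag (p + 1 - j) x)))"
    using swap[of 0] by (intro asymp_eq_diff asymp_eq_sum asymp_eq_cmult swap) auto
  then show ?thesis by (simp add: ip_fwd_left ip_bwd_left)
qed

lemma fwd_reflection:
  assumes "1 \<le> j" "j \<le> p + 1"
  shows "(\<lambda>n. ip n fwd (lag j x)) \<doteq> (\<lambda>n. - \<kappa> * ip n fwd (lag (p + 1 - j) x))"
proof -
  have "(\<lambda>n. ip n fwd (lag j x)) \<doteq> (\<lambda>n. - \<kappa> * ip n bwd (lag j x))"
    using v_orthogonal_past[OF assms(1)]
    unfolding asymp_eq_def innovation_decomposition ip_add_left ip_cmult_left by simp
  also have "\<dots> \<doteq> (\<lambda>n. - \<kappa> * ip n fwd (lag (p + 1 - j) x))"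
    by (intro asymp_eq_cmult time_reversal assms)
  finally show ?thesis .
qed

text \<open>
The reflection \<open>j \<mapsto> p + 1 - j\<close> is an involution of \<open>{1..p}\<close>, so applying \<open>fwd_reflection\<close> twice
reproduces the same inner product with the factor \<open>\<kappa>\<^sup>2 < 1\<close>.
\<close>
lemma fwd_orthogonal_regressors:
  assumes "1 \<le> j" "j \<le> p"
  shows "(\<lambda>n. ip n fwd (lag j x)) \<longlonglongrightarrow> 0"
proof -
  have "(\<lambda>n. ip n fwd (lag j x)) \<doteq> (\<lambda>n. - \<kappa> * ip n fwd (lag (p + 1 - j) x))"
    using assms by (intro fwd_reflection) auto
  also have "\<dots> \<doteq> (\<lambda>n. - \<kappa> * (- \<kappa> * ip n fwd (lag (p + 1 - (p + 1 - j)) x)))"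
    using assms by (intro asymp_eq_cmult fwd_reflection) auto
  also have "p + 1 - (p + 1 - j) = j" using assms by simp
  finally have "(\<lambda>n. (1 - \<kappa>\<^sup>2) * ip n fwd (lag j x)) \<longlonglongrightarrow> 0"
    by (simp add: asymp_eq_def algebra_simps power2_eq_square)
  moreover have "\<kappa>\<^sup>2 \<noteq> 1" using abs_\<kappa>_less_1 by (simp add: power2_eq_1_iff) auto
  ultimately show ?thesis
    using tendsto_mult_left[of "\<lambda>n. (1 - \<kappa>\<^sup>2) * ip n fwd (lag j x)" 0 sequentially "1 / (1 - \<kappa>\<^sup>2)"] by simp
qed

lemma fwd_power: "(\<lambda>n. ip n fwd fwd) \<doteq> (\<lambda>n. ip n fwd x)"
proof -
  have "(\<lambda>n. \<Sum>i=1..p. \<theta>_star i * ip n fwd (lag i x)) \<longlonglongrightarrow> 0"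
    by (intro tendsto_null_sum tendsto_mult_right_zero fwd_orthogonal_regressors) auto
  moreover have "ip n fwd fwd = ip n fwd x - (\<Sum>i=1..p. \<theta>_star i * ip n fwd (lag i x))" for n
    using ip_fwd_left[of n fwd] by (simp add: ip_commute)
  ultimately show ?thesis
    using tendsto_minus[of "\<lambda>n. \<Sum>i=1..p. \<theta>_star i * ip n fwd (lag i x)" 0 sequentially]
    by (simp add: asymp_eq_def)
qed

text \<open>
Expanding \<open>lag 1 fwd\<close>, all lags up to \<open>p\<close> are orthogonal to \<open>fwd\<close>. Only lag \<open>p + 1\<close> survives, and
the reflection of lag \<open>p + 1\<close> is lag \<open>0\<close>.
\<close>
lemma fwd_autocorrelation: "(\<lambda>n. ip n fwd (lag 1 fwd)) \<doteq> (\<lambda>n. \<kappa> * \<theta>_star p * ip n fwd fwd)"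
proof -
  have lag_fwd: "lag 1 fwd = (\<lambda>k. lag 1 x k - (\<Sum>i=1..p. \<theta>_star i * lag (i + 1) x k))"
    by (auto simp: fwd_def lag_def algebra_simps)
  have eq: "ip n fwd (lag 1 fwd) = ip n fwd (lag 1 x) - (\<Sum>i=1..<p. \<theta>_star i * ip n fwd (lag (i + 1) x))
      - \<theta>_star p * ip n fwd (lag (p + 1) x)" for n
    unfolding lag_fwd ip_diff_right ip_sum_right
    using p by (simp add: sum.last_plus atLeastLessThanSuc_atLeastAtMost[symmetric])
  have "(\<lambda>n. ip n fwd (lag 1 fwd)) \<doteq> (\<lambda>n. 0 - (\<Sum>i=1..<p. \<theta>_star i * 0) - \<theta>_star p * (- \<kappa> * ip n fwd fwd))"
    unfolding eq
  proof (intro asymp_eq_diff asymp_eq_sum asymp_eq_cmult)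
    show "(\<lambda>n. ip n fwd (lag 1 x)) \<doteq> (\<lambda>n. 0)"
      unfolding asymp_eq_zero using p by (intro fwd_orthogonal_regressors) auto
    show "(\<lambda>n. ip n fwd (lag (i + 1) x)) \<doteq> (\<lambda>n. 0)" if "i \<in> {1..<p}" for i
      unfolding asymp_eq_zero using that by (intro fwd_orthogonal_regressors) auto
    have "(\<lambda>n. ip n fwd (lag (p + 1) x)) \<doteq> (\<lambda>n. - \<kappa> * ip n fwd x)"
      using fwd_reflection[of "p + 1"] by simp
    also have "\<dots> \<doteq> (\<lambda>n. - \<kappa> * ip n fwd fwd)"
      by (intro asymp_eq_cmult asymp_eq_sym[OF fwd_power])
    finally show "(\<lambda>n. ip n fwd (lag (p + 1) x)) \<doteq> (\<lambda>n. - \<kappa> * ip n fwd fwd)" .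
  qed
  then show ?thesis by (simp add: mult_ac)
qed

text \<open>
Since \<open>fwd = v - \<kappa> * bwd\<close> and \<open>bwd\<close> involves only the past, the power of \<open>fwd\<close> is asymptotically at
least that of the innovation.
\<close>
lemma fwd_power_lower_bound: "eventually (\<lambda>n. s / 2 < ip n fwd fwd) sequentially"
proof -
  have "(\<lambda>n. ip n v v - 2 * \<kappa> * ip n v bwd) \<longlonglongrightarrow> s - 2 * \<kappa> * 0"
  proof (intro tendsto_intros v_power)
    have "(\<lambda>n. ip n v (lag (p + 1) x) - (\<Sum>i=1..p. \<theta>_star i * ip n v (lag (p + 1 - i) x))) \<longlonglongrightarrow> 0 - 0"
      by (intro tendsto_diff tendsto_null_sum tendsto_mult_right_zero v_orthogonal_past) auto
    then show "(\<lambda>n. ip n v bwd) \<longlonglongrightarrow> 0"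
      unfolding bwd_def[abs_def] ip_diff_right ip_sum_right by simp
  qed
  then have "eventually (\<lambda>n. s / 2 < ip n v v - 2 * \<kappa> * ip n v bwd) sequentially"
    using s by (intro order_tendstoD) auto
  then show ?thesis
  proof eventually_elim
    case (elim n)
    have "fwd = (\<lambda>k. v k - \<kappa> * bwd k)" by (simp add: innovation_decomposition)
    then have "ip n fwd fwd = ip n v v - 2 * \<kappa> * ip n v bwd + \<kappa> * \<kappa> * ip n bwd bwd"
      by (simp only: ip_diff_left ip_diff_right ip_cmult_left ip_cmult_right ip_commute[of n bwd v])
    moreover have "0 \<le> \<kappa> * \<kappa> * ip n bwd bwd" by (simp add: ip_nonneg)
    ultimately show ?case using elim by linarith
  qed
qed

text \<open>
A quantitative form of the invertibility of the limiting Gram matrix of the regressors. The inner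
product of \<open>lag j v\<close> with \<open>lag i x\<close> vanishes for \<open>i > j\<close> and tends to \<open>s\<close> for \<open>i = j\<close>. Testing against
\<open>lag j v\<close> for increasing \<open>j\<close> thus determines the coefficients one after the other.
\<close>
lemma coefficients_vanish:
  fixes w :: "nat \<Rightarrow> nat \<Rightarrow> real"
  assumes bound: "\<And>n j. \<bar>w n j\<bar> \<le> 1"
    and power: "(\<lambda>n. ip n (\<lambda>k. \<Sum>j=1..p. w n j * lag j x k) (\<lambda>k. \<Sum>j=1..p. w n j * lag j x k)) \<longlonglongrightarrow> 0"
    and "1 \<le> j" "j \<le> p"
  shows "(\<lambda>n. w n j) \<longlonglongrightarrow> 0"
  using assms(3,4)
proof (induction j rule: less_induct)
  case (less j)
  have product_null: "(\<lambda>n. a n * d n) \<longlonglongrightarrow> 0" if "a \<longlonglongrightarrow> 0" "\<And>n. \<bar>d n\<bar> \<le> C" for a d :: "nat \<Rightarrow> real" and C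
  proof (rule Lim_null_comparison)
    show "(\<lambda>n. \<bar>a n\<bar> * C) \<longlonglongrightarrow> 0" by (intro tendsto_mult_left_zero tendsto_rabs_zero that)
    show "eventually (\<lambda>n. norm (a n * d n) \<le> \<bar>a n\<bar> * C) sequentially"
      by (simp add: abs_mult mult_left_mono that)
  qed
  obtain C where C: "\<And>n i. \<bar>ip n (lag j v) (lag i x)\<bar> \<le> C"
    using ip_bounded[OF bounded_power_lag[OF bounded_power_v causal(3)] bounded_power_x causal(1)] by blast
  have "(\<lambda>n. w n i * ip n (lag j v) (lag i x)) \<longlonglongrightarrow> 0" if i: "i \<in> {1..p} - {j}" for i
  proof (cases "i < j")
    case True
    then show ?thesis using less i C by (intro product_null) auto
  next
    case False
    then have "j < i" using i by auto
    have "(\<lambda>n. ip n (lag j v) (lag j (lag (i - j) x))) \<doteq> (\<lambda>n. ip n v (lag (i - j) x))"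
      using slow_v slow_x causal by (intro ip_lag_asymp slow_lag causal_lag) auto
    then have "(\<lambda>n. ip n (lag j v) (lag i x)) \<longlonglongrightarrow> 0"
      using asymp_eq_tendsto v_orthogonal_past[of "i - j"] \<open>j < i\<close> by (simp add: lag_lag)
    then have "(\<lambda>n. ip n (lag j v) (lag i x) * w n i) \<longlonglongrightarrow> 0"
      using bound by (rule product_null)
    then show ?thesis by (simp add: mult.commute)
  qed
  then have "(\<lambda>n. \<Sum>i\<in>{1..p} - {j}. w n i * ip n (lag j v) (lag i x)) \<longlonglongrightarrow> 0"
    by (intro tendsto_null_sum) auto
  moreover have "(\<lambda>n. ip n (lag j v) (\<lambda>k. \<Sum>i=1..p. w n i * lag i x k)) \<longlonglongrightarrow> 0"
    by (intro ip_negligible bounded_power_lag bounded_power_v causal power)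
  ultimately have "(\<lambda>n. ip n (lag j v) (\<lambda>k. \<Sum>i=1..p. w n i * lag i x k)
      - (\<Sum>i\<in>{1..p} - {j}. w n i * ip n (lag j v) (lag i x))) \<longlonglongrightarrow> 0 - 0"
    by (intro tendsto_diff)
  moreover have "ip n (lag j v) (\<lambda>k. \<Sum>i=1..p. w n i * lag i x k)
      - (\<Sum>i\<in>{1..p} - {j}. w n i * ip n (lag j v) (lag i x)) = w n j * ip n (lag j v) (lag j x)" for n
    unfolding ip_sum_right using less.prems by (simp add: sum.remove[of "{Suc 0..p}" j])
  ultimately have lim: "(\<lambda>n. w n j * ip n (lag j v) (lag j x)) \<longlonglongrightarrow> 0" by simp
  have d: "(\<lambda>n. ip n (lag j v) (lag j x)) \<longlonglongrightarrow> s"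
    by (rule asymp_eq_tendsto[OF ip_lag_asymp v_x_limit]) (use slow_v slow_x causal in auto)
  have "(\<lambda>n. w n j * ip n (lag j v) (lag j x) / ip n (lag j v) (lag j x)) \<longlonglongrightarrow> 0 / s"
    using s by (intro tendsto_divide lim d) auto
  moreover have "eventually (\<lambda>n. ip n (lag j v) (lag j x) > 0) sequentially"
    using d s by (intro order_tendstoD) auto
  then have "eventually (\<lambda>n. w n j * ip n (lag j v) (lag j x) / ip n (lag j v) (lag j x) = w n j) sequentially"
    by eventually_elim simp
  ultimately show ?case by (simp add: tendsto_cong)
qed

section \<open>Least squares and the Durbin-Watson ratio along a path\<close>

definition residual :: "(nat \<Rightarrow> real) \<Rightarrow> int \<Rightarrow> real" where
  "residual a k = x k - (\<Sum>j=1..p. a j * lag j x k)"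

text \<open>
Here \<open>T n\<close> satisfies the regularised normal equations at stage \<open>n\<close>, with an arbitrary positive
semidefinite matrix \<open>S\<close> as regularisation.
\<close>
context
  fixes T :: "nat \<Rightarrow> nat \<Rightarrow> real" and S :: "nat \<Rightarrow> nat \<Rightarrow> real"
  assumes S_nonneg: "\<And>a :: nat \<Rightarrow> real. 0 \<le> (\<Sum>i=1..p. \<Sum>j=1..p. a i * S i j * a j)"
    and normal_eq: "\<And>n i. n \<ge> 1 \<Longrightarrow> 1 \<le> i \<Longrightarrow> i \<le> p \<Longrightarrow>
      (\<Sum>j=1..p. ((\<Sum>k\<le>n. lag i x (int k) * lag j x (int k)) + S i j) * T n j)
        = (\<Sum>k\<le>n. lag i x (int k) * x (int k))"
begin

definition err :: "nat \<Rightarrow> nat \<Rightarrow> real" where "err n j = T n j - \<theta>_star j"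

definition pred_err :: "nat \<Rightarrow> int \<Rightarrow> real" where "pred_err n k = (\<Sum>j=1..p. err n j * lag j x k)"

text \<open>
The amount by which \<open>\<theta>_star\<close> itself violates the normal equations of stage \<open>n\<close>, divided by \<open>n\<close>.
\<close>
definition defect :: "nat \<Rightarrow> nat \<Rightarrow> real" where
  "defect n i = ip n fwd (lag i x) - (\<Sum>j=1..p. S i j * \<theta>_star j) / real n"

lemma residual_eq: "residual (T n) = (\<lambda>k. fwd k - pred_err n k)"
  by (simp add: residual_def fwd_def pred_err_def err_def fun_eq_iff left_diff_distrib sum_subtractf)

lemma error_equation:
  assumes "n \<ge> 1" "1 \<le> i" "i \<le> p"
  shows "ip n (lag i x) (pred_err n) + (\<Sum>j=1..p. S i j * err n j) / real n = defect n i"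
proof -
  have "(\<Sum>j=1..p. (ip n (lag i x) (lag j x) + S i j / real n) * T n j) =
      (\<Sum>j=1..p. ((\<Sum>k\<le>n. lag i x (int k) * lag j x (int k)) + S i j) * T n j) / real n"
    unfolding sum_divide_distrib[where A = "{1..p}"]
    by (intro sum.cong refl) (simp add: ip_def flip: add_divide_distrib)
  also have "\<dots> = ip n (lag i x) x"
    unfolding normal_eq[OF assms] ip_def ..
  finally have "(\<Sum>j=1..p. (ip n (lag i x) (lag j x) + S i j / real n) * T n j) = ip n (lag i x) x" .
  moreover have "(\<Sum>j=1..p. (ip n (lag i x) (lag j x) + S i j / real n) * T n j) =
      (\<Sum>j=1..p. ip n (lag i x) (lag j x) * T n j) + (\<Sum>j=1..p. S i j * T n j) / real n"
    by (simp add: distrib_right sum.distrib sum_divide_distrib)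
  moreover have "ip n (lag i x) (pred_err n) = (\<Sum>j=1..p. ip n (lag i x) (lag j x) * T n j)
      - (\<Sum>j=1..p. ip n (lag i x) (lag j x) * \<theta>_star j)"
    unfolding pred_err_def[abs_def] ip_sum_right err_def by (simp add: algebra_simps sum_subtractf)
  moreover have "ip n fwd (lag i x) = ip n (lag i x) x - (\<Sum>j=1..p. ip n (lag i x) (lag j x) * \<theta>_star j)"
    unfolding ip_fwd_left by (simp add: ip_commute mult.commute)
  moreover have "(\<Sum>j=1..p. S i j * err n j) / real n =
      (\<Sum>j=1..p. S i j * T n j) / real n - (\<Sum>j=1..p. S i j * \<theta>_star j) / real n"
    by (simp add: err_def right_diff_distrib sum_subtractf diff_divide_distrib)
  ultimately show ?thesis unfolding defect_def by linarith
qed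

lemma defect_tendsto_0:
  assumes "1 \<le> i" "i \<le> p"
  shows "(\<lambda>n. defect n i) \<longlonglongrightarrow> 0"
proof -
  have "(\<lambda>n. ip n fwd (lag i x) - (\<Sum>j=1..p. S i j * \<theta>_star j) / real n) \<longlonglongrightarrow> 0 - 0"
    by (intro tendsto_diff fwd_orthogonal_regressors assms lim_const_over_n)
  then show ?thesis by (simp add: defect_def)
qed

lemma pred_err_power_le:
  assumes "n \<ge> 1"
  shows "ip n (pred_err n) (pred_err n) \<le> (\<Sum>i=1..p. \<bar>err n i\<bar> * \<bar>defect n i\<bar>)"
proof -
  have "ip n (pred_err n) (pred_err n) = (\<Sum>i=1..p. err n i * ip n (lag i x) (pred_err n))"
    by (subst (1) pred_err_def[abs_def]) (simp only: ip_sum_left)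
  also have "\<dots> = (\<Sum>i=1..p. err n i * (defect n i - (\<Sum>j=1..p. S i j * err n j) / real n))"
  proof (intro sum.cong refl)
    fix i assume "i \<in> {1..p}"
    then have "ip n (lag i x) (pred_err n) = defect n i - (\<Sum>j=1..p. S i j * err n j) / real n"
      using error_equation[OF assms, of i] by simp
    then show "err n i * ip n (lag i x) (pred_err n) = err n i * (defect n i - (\<Sum>j=1..p. S i j * err n j) / real n)"
      by simp
  qed
  also have "\<dots> = (\<Sum>i=1..p. err n i * defect n i) - (\<Sum>i=1..p. \<Sum>j=1..p. err n i * S i j * err n j) / real n"
    by (simp add: right_diff_distrib sum_subtractf sum_distrib_left sum_divide_distrib mult.assoc)
  also have "\<dots> \<le> (\<Sum>i=1..p. err n i * defect n i)"
    using S_nonneg[of "err n"] by simp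
  also have "\<dots> \<le> (\<Sum>i=1..p. \<bar>err n i\<bar> * \<bar>defect n i\<bar>)"
    by (intro sum_mono) (metis abs_ge_self abs_mult)
  finally show ?thesis .
qed

text \<open>
The power bound is linear in the error, whereas \<open>coefficients_vanish\<close> needs bounded coefficients.
So the error is divided by \<open>m = 1 + \<bar>err\<bar>\<^sub>1\<close>. The normalised error \<open>w\<close> tends to \<open>0\<close>, and
\<open>m = 1 / (1 - \<bar>w\<bar>\<^sub>1)\<close> then shows that \<open>m\<close> tends to \<open>1\<close>.
\<close>
lemma estimator_consistent:
  assumes "1 \<le> j" "j \<le> p"
  shows "(\<lambda>n. err n j) \<longlonglongrightarrow> 0"
proof -
  define m where "m n = 1 + (\<Sum>i=1..p. \<bar>err n i\<bar>)" for n
  define w where "w n j = (if j \<in> {1..p} then err n j / m n else 0)" for n j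
  have m1: "1 \<le> m n" for n by (simp add: m_def sum_nonneg)
  have um: "\<bar>err n i\<bar> \<le> m n" if "i \<in> {1..p}" for n i
  proof -
    have "\<bar>err n i\<bar> \<le> (\<Sum>i=1..p. \<bar>err n i\<bar>)" using that by (intro member_le_sum) auto
    then show ?thesis by (simp add: m_def)
  qed
  have w_lim: "(\<lambda>n. w n i) \<longlonglongrightarrow> 0" if "1 \<le> i" "i \<le> p" for i
    using that
  proof (rule coefficients_vanish[rotated 2])
    show "\<bar>w n j\<bar> \<le> 1" for n j
      using um[of j n] m1[of n] by (simp add: w_def abs_divide)
    have eq: "(\<lambda>k. \<Sum>j=1..p. w n j * lag j x k) = (\<lambda>k. 1 / m n * pred_err n k)" for n
      by (simp add: w_def pred_err_def sum_distrib_left)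
    have le: "ip n (\<lambda>k. \<Sum>j=1..p. w n j * lag j x k) (\<lambda>k. \<Sum>j=1..p. w n j * lag j x k)
        \<le> (\<Sum>i=1..p. \<bar>defect n i\<bar>)" if "n \<ge> 1" for n
    proof -
      have "ip n (\<lambda>k. 1 / m n * pred_err n k) (\<lambda>k. 1 / m n * pred_err n k) = ip n (pred_err n) (pred_err n) / (m n * m n)"
        unfolding ip_cmult_left ip_cmult_right by simp
      also have "\<dots> \<le> (\<Sum>i=1..p. \<bar>err n i\<bar> * \<bar>defect n i\<bar>) / (m n * m n)"
        by (intro divide_right_mono pred_err_power_le that) simp
      also have "\<dots> \<le> (\<Sum>i=1..p. \<bar>defect n i\<bar>)"
      proof -
        have "\<bar>err n i\<bar> \<le> m n * m n" if "i \<in> {1..p}" for i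
          using um[OF that, of n] mult_mono[OF m1[of n] order_refl[of "m n"]] m1[of n] by linarith
        then have "(\<Sum>i=1..p. \<bar>err n i\<bar> * \<bar>defect n i\<bar>) \<le> (\<Sum>i=1..p. (m n * m n) * \<bar>defect n i\<bar>)"
          by (intro sum_mono mult_right_mono) auto
        moreover have "0 < m n * m n" using m1[of n] by simp
        ultimately show ?thesis by (simp add: sum_distrib_left[symmetric] divide_le_eq mult.commute)
      qed
      finally show ?thesis unfolding eq .
    qed
    show "(\<lambda>n. ip n (\<lambda>k. \<Sum>j=1..p. w n j * lag j x k) (\<lambda>k. \<Sum>j=1..p. w n j * lag j x k)) \<longlonglongrightarrow> 0"
    proof (rule Lim_null_comparison)
      show "(\<lambda>n. \<Sum>i=1..p. \<bar>defect n i\<bar>) \<longlonglongrightarrow> 0"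
        by (intro tendsto_null_sum tendsto_rabs_zero defect_tendsto_0) auto
    qed (rule eventually_sequentiallyI[of 1], use le in \<open>simp add: ip_nonneg\<close>)
  qed
  have W: "(\<lambda>n. \<Sum>i=1..p. \<bar>w n i\<bar>) \<longlonglongrightarrow> 0"
    by (intro tendsto_null_sum tendsto_rabs_zero w_lim) auto
  have m_eq: "m n = 1 / (1 - (\<Sum>i=1..p. \<bar>w n i\<bar>))" for n
  proof -
    have "(\<Sum>i=1..p. \<bar>w n i\<bar>) = (m n - 1) / m n"
      using m1[of n] by (simp add: w_def abs_divide sum_divide_distrib[symmetric] m_def[symmetric])
         (simp add: m_def)
    then show ?thesis using m1[of n] by (simp add: diff_divide_distrib)
  qed
  have "(\<lambda>n. 1 / (1 - (\<Sum>i=1..p. \<bar>w n i\<bar>))) \<longlonglongrightarrow> 1 / (1 - 0)"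
    by (intro tendsto_intros W) simp
  then have "(\<lambda>n. w n j * m n) \<longlonglongrightarrow> 0 * (1 / (1 - 0))"
    unfolding m_eq by (intro tendsto_mult w_lim assms)
  moreover have "w n j * m n = err n j" for n
    using assms m1[of n] by (simp add: w_def)
  ultimately show ?thesis by simp
qed

lemma pred_err_power_tendsto_0: "(\<lambda>n. ip n (pred_err n) (pred_err n)) \<longlonglongrightarrow> 0"
proof (rule Lim_null_comparison)
  show "(\<lambda>n. \<Sum>i=1..p. \<bar>err n i\<bar> * \<bar>defect n i\<bar>) \<longlonglongrightarrow> 0"
    by (intro tendsto_null_sum tendsto_mult_zero tendsto_rabs_zero defect_tendsto_0 estimator_consistent) auto
qed (rule eventually_sequentiallyI[of 1], use pred_err_power_le in \<open>simp add: ip_nonneg\<close>)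

text \<open>
Up to vanishing terms the residuals may be replaced by \<open>fwd\<close>. Expanding the squares, the numerator
becomes twice the power of \<open>fwd\<close> minus twice its lag-one autocovariance.
\<close>
lemma Durbin_Watson_limit:
  "(\<lambda>n. (\<Sum>k=1..n. (residual (T n) (int k) - residual (T n) (int k - 1))\<^sup>2) / (\<Sum>k\<le>n. (residual (T n) (int k))\<^sup>2))
     \<longlonglongrightarrow> 2 * (1 - \<kappa> * \<theta>_star p)"
proof -
  define num where "num n = (\<Sum>k=1..n. (residual (T n) (int k) - residual (T n) (int k - 1))\<^sup>2) / real n" for n
  define den where "den n = ip n (residual (T n)) (residual (T n))" for n
  define D where "D = 2 * (1 - \<kappa> * \<theta>_star p)"
  have causal_pred_err: "causal (pred_err n)" for n
    unfolding pred_err_def[abs_def] using causal(1) by (intro causal_combination) auto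
  have lag_pred_err: "(\<lambda>n. ip n (lag 1 (pred_err n)) (lag 1 (pred_err n))) \<longlonglongrightarrow> 0"
    by (rule Lim_null_comparison[OF _ pred_err_power_tendsto_0]) (simp add: ip_nonneg ip_lag_le causal_pred_err)
  have lag_residual: "lag 1 (residual (T n)) = (\<lambda>k. lag 1 fwd k - lag 1 (pred_err n) k)" for n
    by (simp add: residual_eq lag_def)
  have lag_fwd_power: "bounded_power (lag 1 fwd)" by (intro bounded_power_lag bounded_power_fwd causal_fwd)
  have den: "den \<doteq> (\<lambda>n. ip n fwd fwd)"
    unfolding den_def residual_eq
    by (intro ip_perturb bounded_power_fwd pred_err_power_tendsto_0)
  have slow_fwd: "slow fwd"
    unfolding fwd_def[abs_def]
    by (intro slow_diff slow_combination slow_x slow_lag causal)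
  have "(\<lambda>n. ip n (lag 1 (residual (T n))) (lag 1 (residual (T n)))) \<doteq> (\<lambda>n. ip n (lag 1 fwd) (lag 1 fwd))"
    unfolding lag_residual by (intro ip_perturb lag_fwd_power lag_pred_err)
  also have "\<dots> \<doteq> (\<lambda>n. ip n fwd fwd)" by (intro ip_lag_asymp slow_fwd causal_fwd)
  finally have lagged: "(\<lambda>n. ip n (lag 1 (residual (T n))) (lag 1 (residual (T n)))) \<doteq> (\<lambda>n. ip n fwd fwd)" .
  have "(\<lambda>n. ip n (residual (T n)) (lag 1 (residual (T n)))) \<doteq> (\<lambda>n. ip n fwd (lag 1 fwd))"
    unfolding lag_residual unfolding residual_eq
    by (intro ip_perturb bounded_power_fwd lag_fwd_power lag_pred_err pred_err_power_tendsto_0)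
  also have "\<dots> \<doteq> (\<lambda>n. \<kappa> * \<theta>_star p * ip n fwd fwd)" by (rule fwd_autocorrelation)
  finally have cross: "(\<lambda>n. ip n (residual (T n)) (lag 1 (residual (T n)))) \<doteq> (\<lambda>n. \<kappa> * \<theta>_star p * ip n fwd fwd)" .
  have residual_0: "residual (T n) 0 = x 0" "residual (T n) (-1) = 0" for n
    using causal(1) by (simp_all add: residual_def lag_def causal_def sum.neutral)
  \<comment> \<open>the term at \<open>k = 0\<close> of the full sum is \<open>(x 0)\<^sup>2\<close>, because the residual is \<open>x 0\<close> at time \<open>0\<close> and \<open>0\<close> at time \<open>-1\<close>\<close>
  have num_eq: "num n = den n + ip n (lag 1 (residual (T n))) (lag 1 (residual (T n)))
      - 2 * ip n (residual (T n)) (lag 1 (residual (T n))) - (x 0)\<^sup>2 / real n" for n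
  proof -
    have "(\<Sum>k\<le>n. (residual (T n) (int k) - residual (T n) (int k - 1))\<^sup>2) =
        (\<Sum>k=1..n. (residual (T n) (int k) - residual (T n) (int k - 1))\<^sup>2) + (x 0)\<^sup>2"
      by (simp add: atMost_atLeast0 sum.atLeast_Suc_atMost residual_0)
    then have "num n = ip n (\<lambda>k. residual (T n) k - lag 1 (residual (T n)) k) (\<lambda>k. residual (T n) k - lag 1 (residual (T n)) k)
        - (x 0)\<^sup>2 / real n"
      by (simp add: num_def ip_def lag_def power2_eq_square add_divide_distrib)
    then show ?thesis
      using ip_commute[of n "lag 1 (residual (T n))" "residual (T n)"]
      by (simp add: den_def ip_diff_left ip_diff_right)
  qed
  have "(\<lambda>n. num n - D * den n) \<doteq>
      (\<lambda>n. (ip n fwd fwd + ip n fwd fwd - 2 * (\<kappa> * \<theta>_star p * ip n fwd fwd) - 0) - D * ip n fwd fwd)"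
    unfolding num_eq
    by (intro asymp_eq_diff asymp_eq_add asymp_eq_cmult den lagged cross)
       (simp add: asymp_eq_zero lim_const_over_n)
  then have diff: "(\<lambda>n. num n - D * den n) \<longlonglongrightarrow> 0"
    by (simp add: D_def asymp_eq_def algebra_simps)
  have "eventually (\<lambda>n. \<bar>den n - ip n fwd fwd\<bar> < s / 4) sequentially"
    using tendsto_rabs[OF den[unfolded asymp_eq_def]] s by (intro order_tendstoD) auto
  then have den_pos: "eventually (\<lambda>n. s / 4 < den n) sequentially"
    using fwd_power_lower_bound by eventually_elim linarith
  have "(\<lambda>n. num n / den n - D) \<longlonglongrightarrow> 0"
  proof (rule Lim_null_comparison)
    show "(\<lambda>n. 4 / s * \<bar>num n - D * den n\<bar>) \<longlonglongrightarrow> 0"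
      by (intro tendsto_mult_right_zero tendsto_rabs_zero diff)
    show "eventually (\<lambda>n. norm (num n / den n - D) \<le> 4 / s * \<bar>num n - D * den n\<bar>) sequentially"
      using den_pos
    proof eventually_elim
      case (elim n)
      have "num n / den n - D = (num n - D * den n) * (1 / den n)"
        using elim s by (simp add: field_simps)
      moreover have "1 / den n \<le> 4 / s" "0 < den n" using elim s by (simp_all add: field_simps)
      ultimately show ?case
        using mult_right_mono[of "1 / den n" "4 / s" "\<bar>num n - D * den n\<bar>"]
        by (simp add: abs_mult mult.commute)
    qed
  qed
  then have "(\<lambda>n. num n / den n) \<longlonglongrightarrow> D" by (rule LIM_zero_cancel)
  moreover have "eventually (\<lambda>n. num n / den n =
      (\<Sum>k=1..n. (residual (T n) (int k) - residual (T n) (int k - 1))\<^sup>2) / (\<Sum>k\<le>n. (residual (T n) (int k))\<^sup>2)) sequentially"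
    using eventually_gt_at_top[of 0]
    by eventually_elim (simp add: num_def den_def ip_def power2_eq_square)
  ultimately show ?thesis unfolding D_def by (simp add: tendsto_cong)
qed

end

end

section \<open>Matrix form of the estimator\<close>

lemma scalar_prod_mult_mat_vec:
  fixes A :: "real mat"
  assumes "A \<in> carrier_mat p p" "w \<in> carrier_vec p"
  shows "w \<bullet> (A *\<^sub>v w) = (\<Sum>i<p. \<Sum>j<p. w $ i * A $$ (i, j) * w $ j)"
  using assms
  by (simp add: scalar_prod_def sum_distrib_left mult.assoc atLeast0LessThan)

text \<open>
A positive definite matrix has trivial kernel, so its inverse is actually computed by
\<^term>\<open>mat_inverse\<close> and the estimator does not take a default value.
\<close>
lemma pos_def_mat_inverse:
  fixes A :: "real mat"
  assumes A: "A \<in> carrier_mat p p"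
    and pos: "\<And>w. w \<in> carrier_vec p \<Longrightarrow> w \<noteq> 0\<^sub>v p \<Longrightarrow> 0 < w \<bullet> (A *\<^sub>v w)"
  shows "the (mat_inverse A) \<in> carrier_mat p p" "A * the (mat_inverse A) = 1\<^sub>m p"
proof -
  have "det A \<noteq> 0"
  proof
    assume "det A = 0"
    then obtain w where w: "w \<in> carrier_vec p" "w \<noteq> 0\<^sub>v p" "A *\<^sub>v w = 0\<^sub>v p"
      using det_0_iff_vec_prod_zero[OF A] by blast
    then show False using pos[of w] by simp
  qed
  then have "A \<in> Units (ring_mat TYPE(real) p ())"
    by (rule det_non_zero_imp_unit[OF A])
  then obtain B where B: "mat_inverse A = Some B"
    using mat_inverse(1)[OF A, of "()"] by (cases "mat_inverse A") auto
  with mat_inverse(2)[OF A B]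
  show "the (mat_inverse A) \<in> carrier_mat p p" "A * the (mat_inverse A) = 1\<^sub>m p"
    by auto
qed

lemma dim_Phi: "dim_vec (Phi p X n \<omega>) = p"
  by (simp add: Phi_def)

lemma Smat_entry:
  assumes "S \<in> carrier_mat p p" "i < p" "j < p"
  shows "Smat p X S n \<omega> $$ (i, j) = (\<Sum>k=0..n. Phi p X k \<omega> $ i * Phi p X k \<omega> $ j) + S $$ (i, j)"
  using assms by (simp add: Smat_def)

text \<open>
The sum of the rank-one matrices is positive semidefinite and \<open>S\<close> is positive definite.
\<close>
lemma theta_hat_normal_equations:
  assumes S: "sym_pos_def p S" and "i < p"
  shows "(\<Sum>j<p. Smat p X S (n - 1) \<omega> $$ (i, j) * theta_hat p X S n \<omega> $ j)
    = (\<Sum>k=1..n. Phi p X (k - 1) \<omega> $ i * X (int k) \<omega>)"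
proof -
  define A where "A = Smat p X S (n - 1) \<omega>"
  define y where "y = vec p (\<lambda>i. \<Sum>k=1..n. Phi p X (k - 1) \<omega> $ i * X (int k) \<omega>)"
  have SC: "S \<in> carrier_mat p p" using S by (simp add: sym_pos_def_def)
  then have A: "A \<in> carrier_mat p p" by (simp add: A_def Smat_def)
  have "0 < w \<bullet> (A *\<^sub>v w)" if w: "w \<in> carrier_vec p" "w \<noteq> 0\<^sub>v p" for w
  proof -
    have "(\<Sum>i<p. \<Sum>j<p. w $ i * (\<Sum>k=0..n-1. Phi p X k \<omega> $ i * Phi p X k \<omega> $ j) * w $ j)
        = (\<Sum>k=0..n-1. (\<Sum>i<p. w $ i * Phi p X k \<omega> $ i)\<^sup>2)"
    proof -
      have "(\<Sum>k=0..n-1. (\<Sum>i<p. w $ i * Phi p X k \<omega> $ i)\<^sup>2) =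
          (\<Sum>k=0..n-1. \<Sum>i<p. \<Sum>j<p. w $ i * (Phi p X k \<omega> $ i * Phi p X k \<omega> $ j) * w $ j)"
        by (simp add: power2_eq_square sum_product mult_ac)
      also have "\<dots> = (\<Sum>i<p. \<Sum>j<p. \<Sum>k=0..n-1. w $ i * (Phi p X k \<omega> $ i * Phi p X k \<omega> $ j) * w $ j)"
        by (rule trans[OF sum.swap], rule sum.cong[OF refl], rule sum.swap)
      finally show ?thesis by (simp add: sum_distrib_left sum_distrib_right)
    qed
    also have "\<dots> \<ge> 0" by (intro sum_nonneg) simp
    finally have "0 \<le> (\<Sum>i<p. \<Sum>j<p. w $ i * (\<Sum>k=0..n-1. Phi p X k \<omega> $ i * Phi p X k \<omega> $ j) * w $ j)" .
    moreover have "0 < w \<bullet> (S *\<^sub>v w)" using S w by (simp add: sym_pos_def_def)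
    moreover have "w \<bullet> (A *\<^sub>v w) =
        (\<Sum>i<p. \<Sum>j<p. w $ i * (\<Sum>k=0..n-1. Phi p X k \<omega> $ i * Phi p X k \<omega> $ j) * w $ j) + w \<bullet> (S *\<^sub>v w)"
      unfolding scalar_prod_mult_mat_vec[OF A w(1)] scalar_prod_mult_mat_vec[OF SC w(1)]
      by (simp add: A_def Smat_entry[OF SC] distrib_left distrib_right sum.distrib)
    ultimately show ?thesis by linarith
  qed
  note inv = pos_def_mat_inverse[OF A this]
  have y: "y \<in> carrier_vec p" by (simp add: y_def)
  have theta: "theta_hat p X S n \<omega> = the (mat_inverse A) *\<^sub>v y"
    by (simp add: theta_hat_def A_def y_def)
  have "A *\<^sub>v theta_hat p X S n \<omega> = y"
    unfolding theta using assoc_mult_mat_vec[OF A inv(1) y] inv(2) y by simp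
  then have "(A *\<^sub>v theta_hat p X S n \<omega>) $ i = y $ i" by simp
  moreover have "theta_hat p X S n \<omega> \<in> carrier_vec p" unfolding theta using inv(1) y by simp
  ultimately show ?thesis
    using A \<open>i < p\<close> unfolding A_def[symmetric] by (simp add: y_def scalar_prod_def atLeast0LessThan)
qed

lemma theta_star_entry:
  assumes "i < p"
  shows "theta_star p \<theta> \<rho> $ i =
    alpha p \<theta> \<rho> * (beta p \<theta> \<rho> $ i - \<theta> $ (p - 1) * \<rho> * beta p \<theta> \<rho> $ (p - 1 - i))"
proof -
  have idx: "i + j = p - 1 \<longleftrightarrow> j = p - 1 - i" for j using assms by auto
  have "theta_star p \<theta> \<rho> $ i = alpha p \<theta> \<rho> *
      (\<Sum>j<p. ((if i = j then 1 else 0) - \<theta> $ (p - 1) * \<rho> * (if j = p - 1 - i then 1 else 0)) * beta p \<theta> \<rho> $ j)"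
    using assms idx by (simp add: theta_star_def exchange_mat_def scalar_prod_def beta_def atLeast0LessThan)
  also have "(\<Sum>j<p. ((if i = j then 1 else 0) - \<theta> $ (p - 1) * \<rho> * (if j = p - 1 - i then 1 else 0)) * beta p \<theta> \<rho> $ j)
      = (\<Sum>j<p. (if i = j then beta p \<theta> \<rho> $ j else 0)) -
        (\<Sum>j<p. if j = p - 1 - i then \<theta> $ (p - 1) * \<rho> * beta p \<theta> \<rho> $ j else 0)"
    unfolding sum_subtractf[symmetric] by (intro sum.cong refl) (simp add: left_diff_distrib)
  also have "\<dots> = beta p \<theta> \<rho> $ i - \<theta> $ (p - 1) * \<rho> * beta p \<theta> \<rho> $ (p - 1 - i)"
    using assms by (simp add: sum.delta sum.delta')
  finally show ?thesis .
qed

section \<open>Almost sure convergence\<close>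

text \<open>
The innovations along a path, with the initial value of the process in place of \<open>V 0\<close>, which does
not occur in the model.
\<close>
definition noise_path :: "real \<Rightarrow> (nat \<Rightarrow> real) \<Rightarrow> int \<Rightarrow> real" where
  "noise_path x0 V k = (if k < 0 then 0 else if k = 0 then x0 else V (nat k))"

lemma ip_noise_path_self:
  assumes "(\<lambda>n. (\<Sum>k<n. (V (Suc k))\<^sup>2) / real n) \<longlonglongrightarrow> s"
  shows "(\<lambda>n. ip n (noise_path x0 V) (noise_path x0 V)) \<longlonglongrightarrow> s"
proof -
  have "(\<lambda>n. x0\<^sup>2 / real n + (\<Sum>k<n. (V (Suc k))\<^sup>2) / real n) \<longlonglongrightarrow> 0 + s"
    by (intro tendsto_add lim_const_over_n assms)
  then show ?thesis
    by (simp add: ip_def noise_path_def sum.atMost_shift nat_add_distrib power2_eq_square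
        add_divide_distrib del: of_nat_Suc)
qed

text \<open>
The initial value enters only through the product \<open>V j * x0\<close>, which disappears after division by \<open>n\<close>.
\<close>
lemma ip_noise_path_lag:
  assumes "(\<lambda>n. (\<Sum>k<n. V (Suc k + j) * V (Suc k)) / real n) \<longlonglongrightarrow> 0" "j \<ge> 1"
  shows "(\<lambda>n. ip n (noise_path x0 V) (lag j (noise_path x0 V))) \<longlonglongrightarrow> 0"
proof (rule LIMSEQ_offset[of _ j])
  let ?v = "noise_path x0 V"
  have sum: "(\<Sum>k\<le>n + j. ?v (int k) * lag j ?v (int k)) = V j * x0 + (\<Sum>k<n. V (Suc k + j) * V (Suc k))" for n
  proof -
    have "(\<Sum>k\<le>n + j. ?v (int k) * lag j ?v (int k)) = (\<Sum>k=0+j..n + j. ?v (int k) * lag j ?v (int k))"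
      by (rule sum.mono_neutral_right) (auto simp: lag_def noise_path_def)
    also have "\<dots> = (\<Sum>k\<le>n. ?v (int (k + j)) * lag j ?v (int (k + j)))"
      unfolding sum.shift_bounds_cl_nat_ivl by (simp add: atMost_atLeast0)
    also have "\<dots> = V j * x0 + (\<Sum>k<n. V (Suc k + j) * V (Suc k))"
      using assms(2) unfolding sum.atMost_shift
      by (auto simp: lag_def noise_path_def nat_add_distrib Suc_nat_eq_nat_zadd1 intro!: sum.cong)
    finally show ?thesis .
  qed
  have "(\<lambda>n. V j * x0 / real (n + j) + (\<Sum>k<n. V (Suc k + j) * V (Suc k)) / real n * (real n / real (n + j)))
      \<longlonglongrightarrow> 0 + 0 * 1"
  proof (intro tendsto_add tendsto_mult assms(1))
    show "(\<lambda>n. V j * x0 / real (n + j)) \<longlonglongrightarrow> 0"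
      by (rule LIMSEQ_ignore_initial_segment[OF lim_const_over_n])
    show "(\<lambda>n. real n / real (n + j)) \<longlonglongrightarrow> 1" by real_asymp
  qed
  moreover have "eventually (\<lambda>n. V j * x0 / real (n + j) +
      (\<Sum>k<n. V (Suc k + j) * V (Suc k)) / real n * (real n / real (n + j)) = ip (n + j) ?v (lag j ?v)) sequentially"
    using eventually_gt_at_top[of 0]
    by eventually_elim (simp only: ip_def sum, simp add: add_divide_distrib)
  ultimately show "(\<lambda>n. ip (n + j) ?v (lag j ?v)) \<longlonglongrightarrow> 0"
    by (simp add: tendsto_cong)
qed

text \<open>
Translation of the model into \<^locale>\<open>autoregressive_path\<close>: vectors indexed from \<open>0\<close> become
functions on \<open>{1..p}\<close>, and the sum over \<open>\<Phi>\<^sub>0, \<dots>, \<Phi>\<^sub>n\<^sub>-\<^sub>1\<close> becomes a sum over \<open>k \<le> n\<close> of lagged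
values, whose term at \<open>k = 0\<close> is \<open>0\<close>.
\<close>
lemma DW_tendsto_pathwise:
  fixes X :: "int \<Rightarrow> 'a \<Rightarrow> real" and \<epsilon> V :: "nat \<Rightarrow> 'a \<Rightarrow> real" and \<theta> :: "real vec"
  assumes "p \<ge> 1" and \<theta>: "\<theta> \<in> carrier_vec p" "norm1 \<theta> < 1" and "\<bar>\<rho>\<bar> < 1"
    and S: "sym_pos_def p S"
    and X_rec: "\<And>n. n \<ge> 1 \<Longrightarrow>
      X (int n) \<omega> = (\<Sum>i=1..p. \<theta> $ (i - 1) * X (int n - int i) \<omega>) + \<epsilon> n \<omega>"
    and eps_rec: "\<And>n. n \<ge> 1 \<Longrightarrow> \<epsilon> n \<omega> = \<rho> * \<epsilon> (n - 1) \<omega> + V n \<omega>"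
    and X_0: "X 0 \<omega> = \<epsilon> 0 \<omega>"
    and X_neg: "\<And>i. 1 \<le> i \<Longrightarrow> i \<le> p \<Longrightarrow> X (- int i) \<omega> = 0"
    and "0 < s"
    and V_sq: "(\<lambda>n. (\<Sum>k<n. (V (Suc k) \<omega>)\<^sup>2) / real n) \<longlonglongrightarrow> s"
    and V_lag: "\<And>j. j \<ge> 1 \<Longrightarrow> (\<lambda>n. (\<Sum>k<n. V (Suc k + j) \<omega> * V (Suc k) \<omega>) / real n) \<longlonglongrightarrow> 0"
  shows "(\<lambda>n. DW p X S n \<omega>) \<longlonglongrightarrow> D_star p \<theta> \<rho>"
proof -
  define x where "x k = (if k < 0 then 0 else X k \<omega>)" for k :: int
  define e where "e k = (if k < 0 then 0 else \<epsilon> (nat k) \<omega>)" for k :: int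
  define v where "v = noise_path (X 0 \<omega>) (\<lambda>k. V k \<omega>)"
  define \<phi> where "\<phi> i = \<theta> $ (i - 1)" for i
  have X_eq: "X k \<omega> = x k" if "- int p \<le> k" for k
  proof (cases "k < 0")
    case True
    then show ?thesis using X_neg[of "nat (- k)"] that by (simp add: x_def)
  qed (simp add: x_def)
  interpret path: autoregressive_path p \<phi> \<rho> s x e v
  proof
    show "(\<Sum>i=1..p. \<bar>\<phi> i\<bar>) < 1"
      using \<theta> by (simp add: \<phi>_def norm1_def sum.atLeast1_atMost_eq)
    show "causal x" "causal e" "causal v"
      by (simp_all add: causal_def x_def e_def v_def noise_path_def)
    show "x k = (\<Sum>i=1..p. \<phi> i * lag i x k) + e k" for k
    proof (cases "k \<ge> 1")
      case True
      then obtain n where n: "k = int n" "n \<ge> 1" by (metis nat_0_le nat_le_iff of_nat_1 of_nat_le_iff order_trans zero_le_one)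
      have "x k = X (int n) \<omega>" by (simp add: x_def n)
      also have "\<dots> = (\<Sum>i=1..p. \<phi> i * lag i x k) + e k"
        unfolding X_rec[OF n(2)] by (simp add: \<phi>_def lag_def n X_eq e_def)
      finally show ?thesis .
    next
      case False
      then have "lag i x k = 0" if "i \<ge> 1" for i using that by (simp add: lag_def x_def)
      then show ?thesis using False X_0 by (cases "k = 0") (auto simp: x_def e_def)
    qed
    show "e k = \<rho> * lag 1 e k + v k" for k
      using eps_rec[of "nat k"] X_0 by (auto simp: e_def lag_def v_def noise_path_def nat_diff_distrib)
    show "(\<lambda>n. ip n v v) \<longlonglongrightarrow> s"
      unfolding v_def by (rule ip_noise_path_self) (rule V_sq)
    show "(\<lambda>n. ip n v (lag j v)) \<longlonglongrightarrow> 0" if "j \<ge> 1" for j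
      unfolding v_def by (rule ip_noise_path_lag) (use that V_lag in auto)
  qed (use assms in auto)

  have SC: "S \<in> carrier_mat p p" using S by (simp add: sym_pos_def_def)
  have Phi: "Phi p X (k - 1) \<omega> $ i = lag (Suc i) x (int k)" if "i < p" "k \<ge> 1" for i k
    using that X_eq[of "int (k - 1) - int i"] by (simp add: Phi_def lag_def of_nat_diff algebra_simps)
  have lag_0: "lag i x 0 = 0" if "i \<ge> 1" for i using that by (simp add: lag_def x_def)
  define T where "T n j = theta_hat p X S n \<omega> $ (j - 1)" for n j
  have S_nonneg: "0 \<le> (\<Sum>i=1..p. \<Sum>j=1..p. a i * S $$ (i - 1, j - 1) * a j)" for a :: "nat \<Rightarrow> real"
  proof -
    define w where "w = vec p (\<lambda>i. a (Suc i))"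
    have w: "w \<in> carrier_vec p" by (simp add: w_def)
    have "0 \<le> w \<bullet> (S *\<^sub>v w)"
      using S w by (cases "w = 0\<^sub>v p") (auto simp: sym_pos_def_def less_imp_le)
    also have "w \<bullet> (S *\<^sub>v w) = (\<Sum>i=1..p. \<Sum>j=1..p. a i * S $$ (i - 1, j - 1) * a j)"
      unfolding scalar_prod_mult_mat_vec[OF SC w] by (simp add: w_def sum.atLeast1_atMost_eq)
    finally show ?thesis .
  qed
  have normal: "(\<Sum>j=1..p. ((\<Sum>k\<le>n. lag i x (int k) * lag j x (int k)) + S $$ (i - 1, j - 1)) * T n j)
      = (\<Sum>k\<le>n. lag i x (int k) * x (int k))" if n: "n \<ge> 1" and i: "1 \<le> i" "i \<le> p" for n i
  proof -
    have from_1: "(\<Sum>k\<le>n. f k) = (\<Sum>k=1..n. f k)" if "f 0 = 0" for f :: "nat \<Rightarrow> real"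
      using that by (simp add: atMost_atLeast0 sum.atLeast_Suc_atMost)
    have entry: "Smat p X S (n - 1) \<omega> $$ (i - 1, j) =
        (\<Sum>k\<le>n. lag i x (int k) * lag (Suc j) x (int k)) + S $$ (i - 1, j)" if "j < p" for j
    proof -
      have "(\<Sum>k=0..n - 1. Phi p X k \<omega> $ (i - 1) * Phi p X k \<omega> $ j) =
          (\<Sum>k=1..n. Phi p X (k - 1) \<omega> $ (i - 1) * Phi p X (k - 1) \<omega> $ j)"
        using n by (intro sum.reindex_bij_witness[of _ "\<lambda>k. k - 1" "\<lambda>k. k + 1"]) auto
      also have "\<dots> = (\<Sum>k=1..n. lag i x (int k) * lag (Suc j) x (int k))"
        using i that Phi[of "i - 1"] Phi[of j] by (intro sum.cong refl) auto
      also have "\<dots> = (\<Sum>k\<le>n. lag i x (int k) * lag (Suc j) x (int k))"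
        using i lag_0 by (subst from_1) auto
      finally show ?thesis using i that by (subst Smat_entry[OF SC]) auto
    qed
    have "(\<Sum>j<p. Smat p X S (n - 1) \<omega> $$ (i - 1, j) * theta_hat p X S n \<omega> $ j)
        = (\<Sum>k=1..n. Phi p X (k - 1) \<omega> $ (i - 1) * X (int k) \<omega>)"
      using i by (intro theta_hat_normal_equations[OF S]) auto
    also have "\<dots> = (\<Sum>k=1..n. lag i x (int k) * x (int k))"
      using i Phi[of "i - 1"] by (intro sum.cong refl) (auto simp: X_eq)
    also have "\<dots> = (\<Sum>k\<le>n. lag i x (int k) * x (int k))"
      using i lag_0 by (subst from_1) auto
    also have "(\<Sum>j<p. Smat p X S (n - 1) \<omega> $$ (i - 1, j) * theta_hat p X S n \<omega> $ j) =
        (\<Sum>j=1..p. ((\<Sum>k\<le>n. lag i x (int k) * lag j x (int k)) + S $$ (i - 1, j - 1)) * T n j)"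
      unfolding T_def One_nat_def sum.atLeast1_atMost_eq
      by (intro sum.cong refl) (use entry in simp)
    finally show ?thesis .
  qed
  have eps_hat: "eps_hat p X S n k \<omega> = path.residual (T n) (int k)" for n k
  proof (cases "k = 0")
    case True
    have "(\<Sum>j=1..p. T n j * lag j x 0) = 0" using lag_0 by (intro sum.neutral) auto
    then show ?thesis using True by (simp add: eps_hat_def path.residual_def X_eq)
  next
    case False
    then have "theta_hat p X S n \<omega> \<bullet> Phi p X (k - 1) \<omega> = (\<Sum>j<p. theta_hat p X S n \<omega> $ j * lag (Suc j) x (int k))"
      using Phi[of _ k] by (simp add: scalar_prod_def dim_Phi atLeast0LessThan)
    then show ?thesis using False
      by (simp add: eps_hat_def path.residual_def T_def sum.atLeast1_atMost_eq X_eq)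
  qed
  have "DW p X S n \<omega> = (\<Sum>k=1..n. (path.residual (T n) (int k) - path.residual (T n) (int k - 1))\<^sup>2) /
      (\<Sum>k\<le>n. (path.residual (T n) (int k))\<^sup>2)" for n
    unfolding DW_def eps_hat
    by (simp add: atMost_atLeast0 divide_inverse mult.commute of_nat_diff cong: sum.cong_simp)
  then have "(\<lambda>n. DW p X S n \<omega>) \<longlonglongrightarrow> 2 * (1 - path.\<kappa> * path.\<theta>_star p)"
    using path.Durbin_Watson_limit[OF S_nonneg normal] by simp
  also have "2 * (1 - path.\<kappa> * path.\<theta>_star p) = D_star p \<theta> \<rho>"
  proof -
    have beta: "beta p \<theta> \<rho> $ i = path.\<beta> (Suc i)" if "i < p" for i
      using that by (cases i) (auto simp: beta_def path.\<beta>_def \<phi>_def)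
    have "theta_star p \<theta> \<rho> $ (p - 1) = path.\<theta>_star p"
      using \<open>p \<ge> 1\<close> by (simp add: theta_star_entry beta path.\<theta>_star_def alpha_def path.\<kappa>_def \<phi>_def)
    then show ?thesis by (simp add: D_star_def rho_star_def path.\<kappa>_def \<phi>_def)
  qed
  finally show ?thesis .
qed

theorem theorem4p1:
  fixes M :: "'a measure" and p :: nat and \<theta> :: "real vec" and \<rho> \<sigma> :: real
    and S :: "real mat"
    and X :: "int \<Rightarrow> 'a \<Rightarrow> real" and \<epsilon> V :: "nat \<Rightarrow> 'a \<Rightarrow> real"
  assumes "prob_space M"
    and "p \<ge> 1"
    and "\<theta> \<in> carrier_vec p" and "\<theta> \<noteq> 0\<^sub>v p" and "norm1 \<theta> < 1"
    and "\<bar>\<rho>\<bar> < 1"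
    and "sym_pos_def p S"
    and X_rec: "\<And>n \<omega>. n \<ge> 1 \<Longrightarrow> \<omega> \<in> space M \<Longrightarrow>
      X (int n) \<omega> = (\<Sum>i=1..p. \<theta> $ (i - 1) * X (int n - int i) \<omega>) + \<epsilon> n \<omega>"
    and eps_rec: "\<And>n \<omega>. n \<ge> 1 \<Longrightarrow> \<omega> \<in> space M \<Longrightarrow> \<epsilon> n \<omega> = \<rho> * \<epsilon> (n - 1) \<omega> + V n \<omega>"
    and X_0: "\<And>\<omega>. \<omega> \<in> space M \<Longrightarrow> X 0 \<omega> = \<epsilon> 0 \<omega>"
    and "X 0 \<in> borel_measurable M" and "integrable M (\<lambda>\<omega>. (X 0 \<omega>)\<^sup>2)"
    and X_neg: "\<And>i \<omega>. 1 \<le> i \<Longrightarrow> i \<le> p \<Longrightarrow> \<omega> \<in> space M \<Longrightarrow> X (- int i) \<omega> = 0"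
    and V_indep: "prob_space.indep_vars M (\<lambda>_. borel) V {1..}"
    and V_ident: "\<And>n. n \<ge> 1 \<Longrightarrow> distr M borel (V n) = distr M borel (V 1)"
    and V_sq: "\<And>n. n \<ge> 1 \<Longrightarrow> integrable M (\<lambda>\<omega>. (V n \<omega>)\<^sup>2)"
    and V_mean: "\<And>n. n \<ge> 1 \<Longrightarrow> prob_space.expectation M (V n) = 0"
    and V_var: "\<And>n. n \<ge> 1 \<Longrightarrow> prob_space.variance M (V n) = \<sigma>\<^sup>2"
    and "\<sigma>\<^sup>2 > 0"
  shows "AE \<omega> in M. (\<lambda>n. DW p X S n \<omega>) \<longlonglongrightarrow> D_star p \<theta> \<rho>"
proof -
  interpret prob_space M by fact
  have V_meas: "random_variable borel (V n)" if "n \<ge> 1" for n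
    using V_indep that by (simp add: indep_vars_def)
  have V_second: "expectation (\<lambda>\<omega>. (V n \<omega>)\<^sup>2) = \<sigma>\<^sup>2" if "n \<ge> 1" for n
    using V_var[OF that] V_mean[OF that] by simp
  have "AE \<omega> in M. (\<lambda>n. (\<Sum>k<n. (V (Suc k) \<omega>)\<^sup>2) / real n) \<longlonglongrightarrow> expectation (\<lambda>\<omega>. (V (Suc 0) \<omega>)\<^sup>2)"
  proof (rule strong_law_nonneg)
    show "random_variable borel (\<lambda>\<omega>. (V (Suc k) \<omega>)\<^sup>2)" for k
      using V_meas[of "Suc k"] by simp
    have square: "distr M borel (\<lambda>\<omega>. (V n \<omega>)\<^sup>2) = distr (distr M borel (V n)) borel (\<lambda>y. y\<^sup>2)" if "n \<ge> 1" for n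
      using distr_distr[of "\<lambda>y::real. y\<^sup>2" borel borel "V n" M] V_meas[OF that] by (simp add: comp_def)
    show "distr M borel (\<lambda>\<omega>. (V (Suc k) \<omega>)\<^sup>2) = distr M borel (\<lambda>\<omega>. (V (Suc 0) \<omega>)\<^sup>2)" for k
      using V_ident[of "Suc k"] by (simp add: square)
    show "indep_var borel (\<lambda>\<omega>. (V (Suc k) \<omega>)\<^sup>2) borel (\<lambda>\<omega>. (V (Suc l) \<omega>)\<^sup>2)" if "k \<noteq> l" for k l
      using that by (intro indep_var_of_indep_vars[OF V_indep]) auto
  qed (use V_sq in auto)
  moreover have "AE \<omega> in M. \<forall>j\<in>{1..}. (\<lambda>n. (\<Sum>k<n. V (Suc k + j) \<omega> * V (Suc k) \<omega>) / real n) \<longlonglongrightarrow> 0"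
    using strong_law_lagged_products[OF V_indep V_sq V_mean V_second] by (simp add: AE_ball_countable)
  ultimately show ?thesis
    using AE_space
  proof eventually_elim
    case (elim \<omega>)
    show ?case
      using assms(2,3,5-7) X_rec eps_rec X_0 X_neg \<open>\<sigma>\<^sup>2 > 0\<close> elim V_second[of 1]
      by (intro DW_tendsto_pathwise[where s = "\<sigma>\<^sup>2" and \<epsilon> = \<epsilon> and V = V]) auto
  qed
qed

end
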